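(* For any integers $d\ge 2$, $k\ge 1$ and any $\gamma>0$ there exists $n_0$ such that for all $n\ge n_0$, \[M_k(d,n)\le \left(1-\frac1{N_k(d)}+\gamma\right)\frac{n^2}{2}.\] Moreover, there is a constant $c=c(k,d,\gamma)>0$ such that the same bound remains valid if in the definition of $M_k(d,n)$ the intervals $[t_i,t_i+1]$ are replaced by the intervals $[t_i,t_i+cn^{1/d}]$.
   Context: A set $P\subseteq\mathbb{R}^d$ is separated if $\|p_1-p_2\|\ge 1$ for all distinct $p_1,p_2\in P$. $M_k(d,n)$ is the largest $M$ for which there exist a separated set $S\subseteq\mathbb{R}^d$ of $n$ points and reals $1\le t_1\le\dots\le t_k$ such that at least $M$ pairs $\{p_1,p_2\}\subseteq S$ satisfy $\|p_1-p_2\|\in\bigcup_{i=1}^k[t_i,t_i+1]$. For $\varepsilon>0$, a separated set $P$ is an $\varepsilon$-nearly $k$-distance set (with distances $1\le t_1<\dots<t_k$) if $\|p_1-p_2\|\in\bigcup_{i=1}^k[t_i,t_i+\varepsilon]$ for all distinct $p_1,p_2\in P$. The angle between a vector $v$ and an affine subspace (plane) $\Lambda$ is the infimum of the angles between $v$ and vectors $w\in\Lambda-\Lambda$. A set $P\subseteq\mathbb{R}^d$ is $(p,d-1,\alpha)$-flat with respect to a hyperplane $\Lambda_p$ if every vector $p-q$, $q\in P$, makes angle at most $\alpha$ with $\Lambda_p$; $P$ is $(d-1,\alpha)$-flat if for every $p\in P$ it is $(p,d-1,\alpha)$-flat with respect to some hyperplane $\Lambda_p$. $N_k(d)$ is the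 largest $N$ such that for every $\varepsilon,\alpha>0$ there exists a $(d-1,\alpha)$-flat $\varepsilon$-nearly $k$-distance set in $\mathbb{R}^d$ of cardinality $N$. *)

theory Defs
  imports "HOL-Analysis.Analysis"
begin

definition separated :: "'a::euclidean_space set \<Rightarrow> bool" where
  "separated P \<longleftrightarrow> (\<forall>p\<in>P. \<forall>q\<in>P. p \<noteq> q \<longrightarrow> dist p q \<ge> 1)"

text \<open>Pairs of distinct points of S whose distance lies in the union of the
  intervals [t i, t i + w], i < k (indices 0..k-1 stand for 1..k).\<close>
definition good_pairs :: "nat \<Rightarrow> real \<Rightarrow> (nat \<Rightarrow> real) \<Rightarrow> 'a::euclidean_space set \<Rightarrow> 'a set set" where
  "good_pairs k w t S = {{p, q} | p q. p \<in> S \<and> q \<in> S \<and> p \<noteq> q \<and>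
      (\<exists>i<k. t i \<le> dist p q \<and> dist p q \<le> t i + w)}"

text \<open>Generalised M_k(d,n) with interval length w; M_k(d,n) itself is the case w = 1.
  The dimension d is DIM('a).\<close>
definition Mw :: "nat \<Rightarrow> real \<Rightarrow> nat \<Rightarrow> 'a::euclidean_space itself \<Rightarrow> nat" where
  "Mw k w n (_ :: 'a itself) = (GREATEST M. \<exists>(S :: 'a set) (t :: nat \<Rightarrow> real).
      finite S \<and> card S = n \<and> separated S \<and>
      1 \<le> t 0 \<and> (\<forall>i. Suc i < k \<longrightarrow> t i \<le> t (Suc i)) \<and>
      card (good_pairs k w t S) \<ge> M)"

definition nearly_k_distance :: "nat \<Rightarrow> real \<Rightarrow> 'a::euclidean_space set \<Rightarrow> bool" where
  "nearly_k_distance k \<epsilon> P \<longleftrightarrow> separated P \<and>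
     (\<exists>t :: nat \<Rightarrow> real. 1 \<le> t 0 \<and> (\<forall>i. Suc i < k \<longrightarrow> t i < t (Suc i)) \<and>
        (\<forall>p\<in>P. \<forall>q\<in>P. p \<noteq> q \<longrightarrow> (\<exists>i<k. t i \<le> dist p q \<and> dist p q \<le> t i + \<epsilon>)))"

definition vec_angle :: "'a::euclidean_space \<Rightarrow> 'a \<Rightarrow> real" where
  "vec_angle v w = arccos ((v \<bullet> w) / (norm v * norm w))"

definition angle_plane :: "'a::euclidean_space \<Rightarrow> 'a set \<Rightarrow> real" where
  "angle_plane v \<Lambda> = Inf {vec_angle v w | w. w \<in> {x - y | x y. x \<in> \<Lambda> \<and> y \<in> \<Lambda>} \<and> w \<noteq> 0}"

definition hyperplane :: "'a::euclidean_space set \<Rightarrow> bool" where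
  "hyperplane \<Lambda> \<longleftrightarrow> affine \<Lambda> \<and> aff_dim \<Lambda> = int DIM('a) - 1"

definition flat_at :: "'a::euclidean_space \<Rightarrow> real \<Rightarrow> 'a set \<Rightarrow> 'a set \<Rightarrow> bool" where
  "flat_at p \<alpha> \<Lambda> P \<longleftrightarrow> hyperplane \<Lambda> \<and> (\<forall>q\<in>P. q \<noteq> p \<longrightarrow> angle_plane (p - q) \<Lambda> \<le> \<alpha>)"

definition flat :: "real \<Rightarrow> 'a::euclidean_space set \<Rightarrow> bool" where
  "flat \<alpha> P \<longleftrightarrow> (\<forall>p\<in>P. \<exists>\<Lambda>. flat_at p \<alpha> \<Lambda> P)"

definition Nk :: "nat \<Rightarrow> 'a::euclidean_space itself \<Rightarrow> nat" where
  "Nk k (_ :: 'a itself) = (GREATEST N. \<forall>\<epsilon>>0. \<forall>\<alpha>>0. \<exists>P :: 'a set.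
      finite P \<and> card P = N \<and> flat \<alpha> P \<and> nearly_k_distance k \<epsilon> P)"

end

theory Submission
  imports Defs
begin

text \<open>Suppose more pairs than claimed have a distance in some \<open>[t i, t i + w]\<close>, where
  \<open>w = c n^(1/d)\<close> and \<open>N = N_k(d)\<close>. For a large constant \<open>K\<close>, a ball of radius \<open>K w\<close> contains only a
  small proportion of the \<open>n\<close> points, because they are separated; so discarding the pairs at distance
  at most \<open>K w\<close> costs little, and the Erdos-Stone argument yields \<open>N + 1\<close> large parts such that
  the points of each part are pairwise further than \<open>K w\<close> apart and the distances between any two
  parts lie in a single interval. By pigeonhole, each part contains points \<open>p, p'\<close> with
  \<open>w << |p - p'| << |p - q|\<close> for all \<open>q\<close> in the other parts. As \<open>|p - q|\<close> and \<open>|p' - q|\<close> differ by at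
  most \<open>w\<close>, the vector \<open>p - q\<close> is nearly orthogonal to \<open>p - p'\<close>. Hence the points \<open>p\<close>, one from each
  part and scaled by \<open>2 / (K w)\<close>, form a flat nearly \<open>k\<close>-distance set of size \<open>N + 1\<close>,
  contradicting the choice of \<open>N\<close>.\<close>

subsection \<open>Colour-homogeneous multipartite subgraphs\<close>

text \<open>Greedy choice: each chosen vertex conflicts with at most \<open>L\<close> vertices of
  \<open>F\<close>, so while these do not exhaust \<open>F\<close> another vertex can be added.
  Reflexivity of \<open>C\<close> makes that vertex a new one.\<close>

lemma ex_sparse_subset:
  fixes C :: "'b \<Rightarrow> 'b \<Rightarrow> bool" and L :: real
  assumes "finite F" and refl: "\<And>x. C x x" and sym: "\<And>x y. C x y \<Longrightarrow> C y x"
    and L: "\<And>x. x \<in> F \<Longrightarrow> card {y\<in>F. C x y} \<le> L" and "0 \<le> L" and "real m * L < card F"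
  shows "\<exists>X\<subseteq>F. card X = m \<and> (\<forall>x\<in>X. \<forall>y\<in>X. x \<noteq> y \<longrightarrow> \<not> C x y)"
  using assms(6)
proof (induction m)
  case 0
  then show ?case by (intro exI[of _ "{}"]) auto
next
  case (Suc m)
  have "real m * L < card F" using Suc.prems \<open>0 \<le> L\<close> by (simp add: algebra_simps)
  then obtain X where X: "X \<subseteq> F" "card X = m" "\<forall>x\<in>X. \<forall>y\<in>X. x \<noteq> y \<longrightarrow> \<not> C x y"
    using Suc.IH by blast
  have finX: "finite X" using X(1) \<open>finite F\<close> finite_subset by blast
  have "real (card (\<Union>x\<in>X. {y\<in>F. C x y})) \<le> (\<Sum>x\<in>X. real (card {y\<in>F. C x y}))"
    using card_UN_le[OF finX, of "\<lambda>x. {y\<in>F. C x y}"] by (simp flip: of_nat_sum)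
  also have "\<dots> \<le> (\<Sum>x\<in>X. L)" using L X(1) by (intro sum_mono) auto
  also have "\<dots> = real m * L" using X(2) by simp
  also have "\<dots> < card F" by fact
  finally have "\<not> F \<subseteq> (\<Union>x\<in>X. {y\<in>F. C x y})"
    using card_mono[of "\<Union>x\<in>X. {y\<in>F. C x y}" F] finX \<open>finite F\<close> by auto
  then obtain z where z: "z \<in> F" "\<forall>x\<in>X. \<not> C x z" by auto
  have "z \<notin> X" using z refl by auto
  then show ?case using z X finX sym
    by (intro exI[of _ "insert z X"]) auto
qed

text \<open>Take \<open>U\<close> maximising the number of ordered edges minus the penalty
  \<open>b * (card U * (card U + 1))\<close> with \<open>b = a + \<gamma> / 2\<close>. Removing a
  vertex lowers the penalty by \<open>2 * b * card U\<close> and the edge count by at most twice the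
  degree, so maximality gives the degree bound. Comparison with \<open>V\<close> itself forces
  \<open>U\<close> to be large.\<close>

lemma dense_ex_min_degree_subset:
  fixes G :: "'b \<Rightarrow> 'b \<Rightarrow> bool" and a \<gamma> :: real
  assumes "finite V" and sym: "\<And>x y. G x y \<Longrightarrow> G y x" and "0 \<le> a" "0 < \<gamma>"
    and dense: "(a + \<gamma>) * card V ^ 2 \<le> card {(x, y) \<in> V \<times> V. G x y}"
    and large: "a + \<gamma> / 2 \<le> \<gamma> / 4 * card V"
  shows "\<exists>U\<subseteq>V. \<gamma> / 4 * card V ^ 2 \<le> real (card U) ^ 2
      \<and> (\<forall>x\<in>U. (a + \<gamma> / 2) * card U \<le> card {y\<in>U. G x y})"
proof -
  define e where "e U = card {(x, y) \<in> U \<times> U. G x y}" for U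
  define b where "b = a + \<gamma> / 2"
  have b: "0 \<le> b" using assms b_def by simp
  define f where "f U = real (e U) - b * (card U * (card U + 1))" for U
  have "Max (f ` Pow V) \<in> f ` Pow V" using \<open>finite V\<close> by (intro Max_in) auto
  then obtain U where U: "U \<in> Pow V" "f U = Max (f ` Pow V)" by auto
  have max: "f X \<le> f U" if "X \<in> Pow V" for X
    unfolding U(2) using that \<open>finite V\<close> by (intro Max_ge) auto
  have finU: "finite U" using U \<open>finite V\<close> finite_subset by auto
  have "\<gamma> / 4 * card V ^ 2 \<le> \<gamma> / 2 * card V ^ 2 - b * card V"
    using mult_right_mono[OF large, of "card V"] by (simp add: b_def power2_eq_square algebra_simps)
  also have "\<dots> \<le> f V" using dense by (simp add: f_def e_def b_def power2_eq_square algebra_simps)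
  also have "\<dots> \<le> f U" using max by simp
  also have "\<dots> \<le> e U" using b by (simp add: f_def)
  also have "e U \<le> card (U \<times> U)" unfolding e_def by (rule card_mono) (use finU in auto)
  finally have 1: "\<gamma> / 4 * card V ^ 2 \<le> real (card U) ^ 2"
    by (simp add: card_cartesian_product power2_eq_square)
  have 2: "b * card U \<le> card {y\<in>U. G x y}" if "x \<in> U" for x
  proof -
    let ?D = "{y\<in>U. G x y}"
    have sub: "{(u, v) \<in> U \<times> U. G u v} \<subseteq>
      {(u, v) \<in> (U - {x}) \<times> (U - {x}). G u v} \<union> (Pair x ` ?D \<union> (\<lambda>y. (y, x)) ` ?D)"
      using sym by auto
    have "e U \<le> card ({(u, v) \<in> (U - {x}) \<times> (U - {x}). G u v} \<union> (Pair x ` ?D \<union> (\<lambda>y. (y, x)) ` ?D))"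
      unfolding e_def by (rule card_mono[OF _ sub]) (use finU in \<open>auto intro: finite_subset[of _ "U \<times> U"]\<close>)
    also have "\<dots> \<le> e (U - {x}) + (card (Pair x ` ?D) + card ((\<lambda>y. (y, x)) ` ?D))"
      unfolding e_def by (meson card_Un_le le_trans add_left_mono)
    also have "\<dots> \<le> e (U - {x}) + 2 * card ?D"
      using card_image_le[of ?D "Pair x"] card_image_le[of ?D "\<lambda>y. (y, x)"] finU by auto
    finally have e: "real (e U) \<le> e (U - {x}) + 2 * card ?D" by linarith
    have c: "card U = card (U - {x}) + 1" using that finU
      by (metis Suc_eq_plus1 card_Suc_Diff1)
    have "f (U - {x}) \<le> f U" using U by (intro max) auto
    then have "2 * (b * card U) \<le> real (e U) - e (U - {x})" by (simp add: f_def c algebra_simps)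
    then show ?thesis using e by linarith
  qed
  show ?thesis using 1 2 U unfolding b_def by blast
qed

lemma pigeonhole_fiber:
  assumes "finite T" "f ` A \<subseteq> T" "T \<noteq> {}" "finite A"
  shows "\<exists>t\<in>T. card A \<le> card T * card {x\<in>A. f x = t}"
proof (rule ccontr)
  assume "\<not> ?thesis"
  then have lt: "\<And>t. t \<in> T \<Longrightarrow> card T * card {x\<in>A. f x = t} < card A" by force
  have "A = (\<Union>t\<in>T. {x\<in>A. f x = t})" using assms by auto
  then have "card A \<le> (\<Sum>t\<in>T. card {x\<in>A. f x = t})"
    using card_UN_le[OF \<open>finite T\<close>] by metis
  then have "card T * card A \<le> (\<Sum>t\<in>T. card T * card {x\<in>A. f x = t})"
    by (metis mult_le_mono2 sum_distrib_left)
  also have "\<dots> < (\<Sum>t\<in>T. card A)" using lt assms by (intro sum_strict_mono) auto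
  finally show False by simp
qed

text \<open>A blow-up of the complete graph on \<open>j\<close> vertices in which each pair of parts
  is joined completely in one colour. Disjointness of the parts is automatic as soon as no vertex is
  joined to itself, as with the distance colours below.\<close>

definition homogeneous_parts ::
  "nat \<Rightarrow> (nat \<Rightarrow> 'b \<Rightarrow> 'b \<Rightarrow> bool) \<Rightarrow> ('b \<Rightarrow> 'b \<Rightarrow> bool) \<Rightarrow> 'b set \<Rightarrow> nat \<Rightarrow> nat \<Rightarrow> (nat \<Rightarrow> 'b set) \<Rightarrow> bool"
  where "homogeneous_parts k E C V j m W \<longleftrightarrow>
    (\<forall>i<j. W i \<subseteq> V \<and> card (W i) = m \<and> (\<forall>x\<in>W i. \<forall>y\<in>W i. x \<noteq> y \<longrightarrow> \<not> C x y)) \<and>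
    (\<forall>i<j. \<forall>l<j. i \<noteq> l \<longrightarrow> (\<exists>c<k. \<forall>x\<in>W i. \<forall>y\<in>W l. E c x y))"

text \<open>This is the Erdos-Stone theorem for \<open>k\<close> edge colours, with parts avoiding the sparse
  relation \<open>C\<close>. Since \<open>C\<close> is reflexive, the bound
  on its degrees also forces \<open>V\<close> to be large.\<close>
lemma homogeneous_multipartite:
  fixes \<gamma> :: real and r k j m :: nat
  assumes "0 < \<gamma>" "1 \<le> r" "1 \<le> k" "j \<le> r + 1"
  shows "\<exists>\<eta>::real. 0 < \<eta> \<and> (\<forall>(V :: 'b set) E C. finite V \<longrightarrow> V \<noteq> {} \<longrightarrow>
      (\<forall>c x y. E c x y \<longrightarrow> E c y x) \<longrightarrow> (\<forall>x. C x x) \<longrightarrow> (\<forall>x y. C x y \<longrightarrow> C y x) \<longrightarrow>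
      (\<forall>x\<in>V. (1 - 1 / r + \<gamma>) * card V \<le> card {y\<in>V. \<exists>c<k. E c x y}) \<longrightarrow>
      (\<forall>x\<in>V. card {y\<in>V. C x y} \<le> \<eta> * card V) \<longrightarrow>
      (\<exists>W. homogeneous_parts k E C V j m W))"
  using \<open>j \<le> r + 1\<close>
proof (induction j arbitrary: m)
  case 0
  then show ?case by (intro exI[of _ 1]) (auto simp: homogeneous_parts_def)
next
  case (Suc j)
  \<comment> \<open>The induction hypothesis is applied with larger parts of size \<open>M\<close>,
    from which the new parts of size \<open>m\<close> are cut out. The choice of \<open>M\<close>
    makes \<open>k * m\<close> at most a fraction \<gamma> / 2 of it.\<close>
  define M where "M = nat \<lceil>2 * k * m / \<gamma>\<rceil> + 1"
  have M: "k * m \<le> M * \<gamma> / 2"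
  proof -
    have "2 * k * m / \<gamma> \<le> M" unfolding M_def by linarith
    then show ?thesis using \<open>0 < \<gamma>\<close> by (simp add: field_simps)
  qed
  have Mpos: "0 < M" by (simp add: M_def)
  \<comment> \<open>A type assigns to each of the \<open>j\<close> old parts a colour and a subset,
    so there are \<open>T\<close> types. A set of \<gamma> / 2 * card V vertices then contains
    \<beta> * card V vertices of one type.\<close>
  define T where "T = (k * 2 ^ M) ^ j"
  have T: "0 < T" using \<open>1 \<le> k\<close> by (simp add: T_def)
  define \<beta> where "\<beta> = \<gamma> / 2 / T"
  have \<beta>: "0 < \<beta>" using \<open>0 < \<gamma>\<close> T by (simp add: \<beta>_def)
  have jr: "j \<le> r + 1" using Suc.prems by simp
  from Suc.IH[OF jr, of M] obtain \<eta>1 :: real where "\<eta>1 > 0" and IH: "\<forall>(V :: 'b set) E C.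
      finite V \<longrightarrow> V \<noteq> {} \<longrightarrow>
      (\<forall>c x y. E c x y \<longrightarrow> E c y x) \<longrightarrow> (\<forall>x. C x x) \<longrightarrow> (\<forall>x y. C x y \<longrightarrow> C y x) \<longrightarrow>
      (\<forall>x\<in>V. (1 - 1 / r + \<gamma>) * card V \<le> card {y\<in>V. \<exists>c<k. E c x y}) \<longrightarrow>
      (\<forall>x\<in>V. card {y\<in>V. C x y} \<le> \<eta>1 * card V) \<longrightarrow>
      (\<exists>W. homogeneous_parts k E C V j M W)"
    by (elim exE conjE) (rule that)
  \<comment> \<open>The second bound leaves room for choosing greedily \<open>m\<close> pairwise
    unrelated vertices among \<beta> * card V.\<close>
  define \<eta> where "\<eta> = min \<eta>1 (\<beta> / (m + 1))"
  have \<eta>: "0 < \<eta>" "\<eta> \<le> \<eta>1" "m * \<eta> < \<beta>"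
  proof -
    show "0 < \<eta>" using \<open>\<eta>1 > 0\<close> \<beta> by (simp add: \<eta>_def)
    show "\<eta> \<le> \<eta>1" by (simp add: \<eta>_def)
    have "m * \<eta> \<le> m * (\<beta> / (m + 1))" by (intro mult_left_mono) (auto simp: \<eta>_def)
    also have "\<dots> < \<beta>" using \<beta> by (simp add: field_simps)
    finally show "m * \<eta> < \<beta>" .
  qed
  show ?case
  proof (intro exI[of _ \<eta>] conjI allI impI)
    show "0 < \<eta>" by fact
    fix V :: "'b set" and E :: "nat \<Rightarrow> 'b \<Rightarrow> 'b \<Rightarrow> bool" and C
    assume V: "finite V" "V \<noteq> {}" and Esym: "\<forall>c x y. E c x y \<longrightarrow> E c y x"
      and Crefl: "\<forall>x. C x x" and Csym: "\<forall>x y. C x y \<longrightarrow> C y x"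
      and deg: "\<forall>x\<in>V. (1 - 1 / r + \<gamma>) * card V \<le> card {y\<in>V. \<exists>c<k. E c x y}"
      and Cdeg: "\<forall>x\<in>V. card {y\<in>V. C x y} \<le> \<eta> * card V"
    have Vpos: "0 < card V" using V by (simp add: card_gt_0_iff)
    have "\<forall>x\<in>V. card {y\<in>V. C x y} \<le> \<eta>1 * card V"
      using Cdeg \<eta>(2) by (meson mult_right_mono of_nat_0_le_iff order_trans)
    from IH[THEN spec, THEN spec, THEN spec, THEN mp, THEN mp, THEN mp, THEN mp, THEN mp, THEN mp, THEN mp,
        OF V Esym Crefl Csym deg this]
    obtain W where "homogeneous_parts k E C V j M W" ..
    then have W: "\<And>i. i < j \<Longrightarrow> W i \<subseteq> V \<and> card (W i) = M \<and> (\<forall>x\<in>W i. \<forall>y\<in>W i. x \<noteq> y \<longrightarrow> \<not> C x y)"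
        and WE: "\<And>i l. i < j \<Longrightarrow> l < j \<Longrightarrow> i \<noteq> l \<Longrightarrow> \<exists>c<k. \<forall>x\<in>W i. \<forall>y\<in>W l. E c x y"
      unfolding homogeneous_parts_def by simp_all
    have cardW: "card (W i) = M" and Wsub: "W i \<subseteq> V" if "i < j" for i using W[OF that] by simp_all
    have finW: "finite (W i)" if "i < j" for i using W[OF that] V finite_subset by blast
    let ?G = "\<lambda>x y. \<exists>c<k. E c x y"
    define d where "d i v = card {u\<in>W i. ?G u v}" for i v
    \<comment> \<open>Bad vertices have fewer than \<open>k * m\<close> edges to some old part, so
      each misses at least \<open>M - k * m\<close> of the possible edges to the parts. Counting the
      edges between \<open>V\<close> and the parts in two ways bounds all missing edges, hence the
      number of bad vertices.\<close>
    define B where "B = {v\<in>V. \<exists>i<j. d i v < k * m}"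
    define A where "A = V - B"
    have finB: "finite B" "B \<subseteq> V" using V by (auto simp: B_def)
    have \<gamma>1: "\<gamma> \<le> 1"
    proof -
      obtain x where "x \<in> V" using V by blast
      then have "(1 - 1 / r + \<gamma>) * card V \<le> card {y\<in>V. \<exists>c<k. E c x y}" using deg by blast
      also have "\<dots> \<le> card V" using V by (simp add: card_mono)
      finally have "1 - 1 / r + \<gamma> \<le> 1" using Vpos by simp
      moreover have "1 / real r \<le> 1" using \<open>1 \<le> r\<close> by simp
      ultimately show ?thesis by simp
    qed
    have dM: "d i v \<le> M" if "i < j" for i v
      using W[OF that] finW[OF that] unfolding d_def by (metis (no_types, lifting) card_mono mem_Collect_eq subsetI)
    have swap: "(\<Sum>v\<in>V. \<Sum>i<j. real (d i v)) = (\<Sum>i<j. \<Sum>u\<in>W i. real (card {v\<in>V. ?G u v}))"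
    proof -
      have "(\<Sum>v\<in>V. \<Sum>i<j. real (d i v)) = (\<Sum>i<j. \<Sum>v\<in>V. real (d i v))" by (rule sum.swap)
      also have "\<dots> = (\<Sum>i<j. \<Sum>u\<in>W i. real (card {v\<in>V. ?G u v}))"
      proof (rule sum.cong[OF refl])
        fix i assume "i \<in> {..<j}"
        then have f: "finite (W i)" using finW by simp
        have "(\<Sum>v\<in>V. real (d i v)) = (\<Sum>v\<in>V. \<Sum>u\<in>W i. if ?G u v then 1 else 0)"
          using f by (simp add: d_def sum.If_cases Int_def conj_commute)
        also have "\<dots> = (\<Sum>u\<in>W i. \<Sum>v\<in>V. if ?G u v then 1 else 0)" by (rule sum.swap)
        also have "\<dots> = (\<Sum>u\<in>W i. real (card {v\<in>V. ?G u v}))"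
          using V by (simp add: sum.If_cases Int_def conj_commute)
        finally show "(\<Sum>v\<in>V. real (d i v)) = (\<Sum>u\<in>W i. real (card {v\<in>V. ?G u v}))" .
      qed
      finally show ?thesis .
    qed
    have low: "j * M * ((1 - 1 / r + \<gamma>) * card V) \<le> (\<Sum>v\<in>V. \<Sum>i<j. real (d i v))"
    proof -
      have "(\<Sum>i<j. \<Sum>u\<in>W i. (1 - 1 / r + \<gamma>) * card V) \<le> (\<Sum>i<j. \<Sum>u\<in>W i. real (card {v\<in>V. ?G u v}))"
      proof (intro sum_mono)
        fix i u assume "i \<in> {..<j}" "u \<in> W i"
        then have "u \<in> V" using Wsub[of i] by auto
        then show "(1 - 1 / r + \<gamma>) * card V \<le> real (card {v\<in>V. ?G u v})" using deg by simp
      qed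
      moreover have "(\<Sum>i<j. \<Sum>u\<in>W i. (1 - 1 / r + \<gamma>) * card V) = (\<Sum>i<j. M * ((1 - 1 / r + \<gamma>) * card V))"
        by (intro sum.cong) (simp_all add: cardW)
      ultimately show ?thesis using swap by simp
    qed
    have "card B * (real M - k * m) = (\<Sum>v\<in>B. real M - k * m)" by simp
    also have "\<dots> \<le> (\<Sum>v\<in>B. \<Sum>i<j. real M - d i v)"
    proof (rule sum_mono)
      fix v assume "v \<in> B"
      then obtain i where i: "i < j" "d i v < k * m" by (auto simp: B_def)
      have "real M - k * m \<le> real M - d i v" using i by (simp add: less_imp_le flip: of_nat_mult)
      also have "\<dots> \<le> (\<Sum>i<j. real M - d i v)"
        using i dM by (intro member_le_sum) auto
      finally show "real M - k * m \<le> (\<Sum>i<j. real M - d i v)" .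
    qed
    also have "\<dots> \<le> (\<Sum>v\<in>V. \<Sum>i<j. real M - d i v)"
      using finB V dM by (intro sum_mono2) (auto intro!: sum_nonneg)
    also have "\<dots> = card V * (j * M) - (\<Sum>v\<in>V. \<Sum>i<j. real (d i v))"
      by (simp add: sum_subtractf)
    also have "\<dots> \<le> card V * (j * M) - j * M * ((1 - 1 / r + \<gamma>) * card V)" using low by simp
    also have "\<dots> = card V * M * (j / r - j * \<gamma>)" by (simp add: algebra_simps)
    finally have B1: "card B * (real M - k * m) \<le> card V * M * (j / r - j * \<gamma>)" .
    have "card B * (real M - k * m) \<le> card V * M * (1 - \<gamma>)"
    proof (cases "j = 0")
      case True
      then have "B = {}" by (simp add: B_def)
      then show ?thesis using \<gamma>1 by simp
    next
      case False
      \<comment> \<open>Here the bound on the number of parts enters: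
        \<open>Suc j \<le> r + 1\<close> means \<open>j \<le> r\<close>, so at most
        \<open>card V * M * (1 - \<gamma>)\<close> edges are missing.\<close>
      have "j / r \<le> 1" using Suc.prems \<open>1 \<le> r\<close> by simp
      moreover have "\<gamma> \<le> j * \<gamma>" using False \<open>0 < \<gamma>\<close> by simp
      ultimately have "card V * M * (j / r - j * \<gamma>) \<le> card V * M * (1 - \<gamma>)"
        by (intro mult_left_mono) auto
      then show ?thesis using B1 by linarith
    qed
    moreover have "card B * (M * (1 - \<gamma> / 2)) \<le> card B * (real M - k * m)"
      using M by (intro mult_left_mono) (auto simp: algebra_simps)
    ultimately have "card B * (1 - \<gamma> / 2) * M \<le> card V * (1 - \<gamma>) * M" by (simp add: algebra_simps)
    then have "card B * (1 - \<gamma> / 2) \<le> card V * (1 - \<gamma>)" using Mpos by simp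
    \<comment> \<open>As 1 - \<gamma> is at most the square of 1 - \<gamma> / 2, cancelling one
      factor leaves a proportion of at least \<gamma> / 2 good vertices.\<close>
    also have "\<dots> \<le> card V * (1 - \<gamma> / 2) * (1 - \<gamma> / 2)"
      using \<open>0 < \<gamma>\<close> by (simp add: algebra_simps)
    finally have "card B \<le> card V * (1 - \<gamma> / 2)" using \<gamma>1 by simp
    moreover have "real (card A) = card V - card B"
      using finB V by (simp add: A_def card_Diff_subset of_nat_diff card_mono)
    ultimately have cardA: "\<gamma> / 2 * card V \<le> card A" by (simp add: algebra_simps)
    have finA: "finite A" "A \<subseteq> V" using V by (auto simp: A_def)

    \<comment> \<open>Pigeonhole on colours: among \<open>k * m\<close> neighbours in
      \<open>W i\<close>, some \<open>m\<close> are joined to \<open>v\<close> in the same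
      colour.\<close>
    have ex: "\<exists>p. fst p < k \<and> snd p \<subseteq> W i \<and> card (snd p) = m \<and> (\<forall>u\<in>snd p. E (fst p) u v)"
      if "v \<in> A" "i < j" for v i
    proof -
      have d: "k * m \<le> d i v" using that by (force simp: A_def B_def)
      have "\<exists>c<k. m \<le> card {u\<in>W i. E c u v}"
      proof (rule ccontr)
        assume "\<not> ?thesis"
        then have lt: "\<And>c. c < k \<Longrightarrow> card {u\<in>W i. E c u v} < m" by force
        have "{u\<in>W i. ?G u v} = (\<Union>c<k. {u\<in>W i. E c u v})" by auto
        then have "d i v \<le> (\<Sum>c<k. card {u\<in>W i. E c u v})"
          using card_UN_le[of "{..<k}" "\<lambda>c. {u\<in>W i. E c u v}"] by (simp only: d_def finite_lessThan)
        also have "\<dots> < (\<Sum>c<k. m)" using lt \<open>1 \<le> k\<close> by (intro sum_strict_mono) (auto simp: lessThan_empty_iff)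
        finally show False using d by simp
      qed
      then obtain c where c: "c < k" "m \<le> card {u\<in>W i. E c u v}" by blast
      then obtain U where "U \<subseteq> {u\<in>W i. E c u v}" "card U = m"
        by (meson obtain_subset_with_card_n)
      then show ?thesis using c by (intro exI[of _ "(c, U)"]) auto
    qed
    \<comment> \<open>\<open>\<tau> v\<close> is the type of \<open>v\<close>;
      \<open>restrict\<close> makes it an element of the finite product \<open>\<T>\<close>.\<close>
    define \<tau> where "\<tau> v = restrict (\<lambda>i. SOME p. fst p < k \<and> snd p \<subseteq> W i \<and> card (snd p) = m
      \<and> (\<forall>u\<in>snd p. E (fst p) u v)) {..<j}" for v
    have \<tau>: "fst (\<tau> v i) < k \<and> snd (\<tau> v i) \<subseteq> W i \<and> card (snd (\<tau> v i)) = m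
      \<and> (\<forall>u\<in>snd (\<tau> v i). E (fst (\<tau> v i)) u v)" if "v \<in> A" "i < j" for v i
      using someI_ex[OF ex[OF that]] that by (simp add: \<tau>_def)
    define \<T> where "\<T> = (\<Pi>\<^sub>E i\<in>{..<j}. {..<k} \<times> Pow (W i))"
    have fin\<T>: "finite \<T>" unfolding \<T>_def using finW by (intro finite_PiE) auto
    have card\<T>: "card \<T> = T"
      using finW cardW by (simp add: \<T>_def T_def card_PiE card_cartesian_product card_Pow)
    have img: "\<tau> ` A \<subseteq> \<T>"
    proof
      fix f assume "f \<in> \<tau> ` A"
      then obtain v where v: "v \<in> A" "f = \<tau> v" by blast
      show "f \<in> \<T>" unfolding \<T>_def
      proof (rule PiE_I)
        fix i assume "i \<in> {..<j}"
        then show "f i \<in> {..<k} \<times> Pow (W i)" using \<tau>[OF v(1), of i] v(2) by (auto simp: mem_Times_iff)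
      next
        fix i assume "i \<notin> {..<j}"
        then show "f i = undefined" using v by (simp add: \<tau>_def)
      qed
    qed
    have "\<T> \<noteq> {}" using card\<T> T by force
    then obtain f where f: "f \<in> \<T>" "card A \<le> card \<T> * card {v\<in>A. \<tau> v = f}"
      using pigeonhole_fiber[OF fin\<T> img _ finA(1)] by blast
    \<comment> \<open>All vertices of \<open>F\<close> are joined to the same
      \<open>m\<close>-subsets in the same colours, so any subset of \<open>F\<close> can serve as
      the additional part.\<close>
    define F where "F = {v\<in>A. \<tau> v = f}"
    have F: "F \<subseteq> V" "finite F" using finA by (auto simp: F_def intro: finite_subset)
    have "real (card A) \<le> T * card F" using f(2) card\<T> unfolding F_def by (metis of_nat_le_iff of_nat_mult)
    then have "\<gamma> / 2 * card V \<le> T * card F" using cardA by linarith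
    then have cardF: "\<beta> * card V \<le> card F" using T by (simp add: \<beta>_def field_simps)
    have "\<exists>X\<subseteq>F. card X = m \<and> (\<forall>x\<in>X. \<forall>y\<in>X. x \<noteq> y \<longrightarrow> \<not> C x y)"
    proof (rule ex_sparse_subset[where L = "\<eta> * card V"])
      fix x assume "x \<in> F"
      have "card {y\<in>F. C x y} \<le> card {y\<in>V. C x y}" using F V by (intro card_mono) auto
      then show "card {y\<in>F. C x y} \<le> \<eta> * card V" using Cdeg \<open>x \<in> F\<close> F(1)
        by (meson of_nat_le_iff order_trans subsetD)
    next
      have "m * \<eta> * card V < \<beta> * card V" using \<eta>(3) Vpos by simp
      then show "m * (\<eta> * card V) < card F" using cardF by (simp add: mult.assoc)
    qed (use F Crefl Csym \<eta>(1) in auto)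
    then obtain X where X: "X \<subseteq> F" "card X = m" "\<forall>x\<in>X. \<forall>y\<in>X. x \<noteq> y \<longrightarrow> \<not> C x y" by blast
    \<comment> \<open>The properties of the subsets \<open>snd (f i)\<close> are read off from a
      vertex of \<open>X\<close>. If \<open>X\<close> is empty, then \<open>m = 0\<close> and empty
      parts do.\<close>
    define W' where "W' i = (if i < j then if X = {} then {} else snd (f i) else X)" for i
    have f': "fst (f i) < k \<and> snd (f i) \<subseteq> W i \<and> card (snd (f i)) = m \<and> (\<forall>u\<in>snd (f i). E (fst (f i)) u v)"
      if "i < j" "v \<in> X" for i v
    proof -
      have "v \<in> A" "\<tau> v = f" using that X by (auto simp: F_def)
      then show ?thesis using \<tau>[OF \<open>v \<in> A\<close> that(1)] by simp
    qed
    have W'sub: "W' i \<subseteq> W i" if "i < j" for i using f'[OF that] that by (auto simp: W'_def)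
    have m0: "m = 0" if "X = {}" using X that by simp
    show "\<exists>W. homogeneous_parts k E C V (Suc j) m W" unfolding homogeneous_parts_def
    proof (intro exI[of _ W'] conjI allI impI)
      fix i assume "i < Suc j"
      then consider "i < j" | "i = j" by linarith
      then have "W' i \<subseteq> V \<and> card (W' i) = m \<and> (\<forall>x\<in>W' i. \<forall>y\<in>W' i. x \<noteq> y \<longrightarrow> \<not> C x y)"
      proof cases
        case 1
        have "card (W' i) = m" using f'[OF 1] m0 1 by (auto simp: W'_def)
        moreover have "W' i \<subseteq> V" using W'sub[OF 1] Wsub[OF 1] by (rule subset_trans)
        moreover have "\<not> C x y" if "x \<in> W' i" "y \<in> W' i" "x \<noteq> y" for x y
          using W[OF 1] that subsetD[OF W'sub[OF 1]] by simp
        ultimately show ?thesis by simp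
      qed (use X F in \<open>auto simp: W'_def\<close>)
      then show "W' i \<subseteq> V" "card (W' i) = m" "\<forall>x\<in>W' i. \<forall>y\<in>W' i. x \<noteq> y \<longrightarrow> \<not> C x y"
        by blast+
    next
      fix i l assume il: "i < Suc j" "l < Suc j" "i \<noteq> l"
      show "\<exists>c<k. \<forall>x\<in>W' i. \<forall>y\<in>W' l. E c x y"
      proof (cases "X = {}")
        case True
        then show ?thesis using \<open>1 \<le> k\<close> by (auto simp: W'_def intro!: exI[of _ 0])
      next
        case False
        then obtain v0 where v0: "v0 \<in> X" by blast
        consider "i < j" "l < j" | "i < j" "l = j" | "i = j" "l < j" using il by linarith
        then show ?thesis
        proof cases
          case 1
          then show ?thesis using WE[OF 1 il(3)] subsetD[OF W'sub[OF 1(1)]] subsetD[OF W'sub[OF 1(2)]] by metis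
        next
          case 2
          then show ?thesis using f'[of i] v0 False by (intro exI[of _ "fst (f i)"]) (auto simp: W'_def)
        next
          case 3
          then show ?thesis using f'[of l] v0 False Esym by (intro exI[of _ "fst (f l)"]) (auto simp: W'_def)
        qed
      qed
    qed
  qed
qed

subsection \<open>Points in balls\<close>

text \<open>Compactness of the unit ball gives one finite net; translating and scaling it covers
  every other ball with the same number of pieces.\<close>

lemma finite_scaled_net:
  fixes \<eta> :: real
  assumes "0 < \<eta>"
  obtains D :: "'a::euclidean_space set" where "finite D"
    "\<And>x R. 0 < R \<Longrightarrow> cball x R \<subseteq> (\<Union>c\<in>D. ball (x + R *\<^sub>R c) (\<eta> * R))"
proof -
  have "cball (0::'a) 1 \<subseteq> (\<Union>c\<in>UNIV. ball c \<eta>)"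
    using assms centre_in_ball by blast
  then obtain D where D: "finite D" "cball (0::'a) 1 \<subseteq> (\<Union>c\<in>D. ball c \<eta>)"
    using compactE_image[OF compact_cball, of UNIV "\<lambda>c. ball c \<eta>"] by (metis open_ball)
  have "cball x R \<subseteq> (\<Union>c\<in>D. ball (x + R *\<^sub>R c) (\<eta> * R))" if "0 < R" for x R
  proof
    fix y assume "y \<in> cball x R"
    then have "(1 / R) *\<^sub>R (y - x) \<in> cball 0 1" using that
      by (simp add: dist_norm norm_minus_commute divide_simps)
    then have "(1 / R) *\<^sub>R (y - x) \<in> (\<Union>c\<in>D. ball c \<eta>)" using D(2) by blast
    then obtain c where c: "c \<in> D" "norm (c - (1 / R) *\<^sub>R (y - x)) < \<eta>"
      by (auto simp only: UN_iff mem_ball dist_norm)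
    have "x + R *\<^sub>R c - y = R *\<^sub>R (c - (1 / R) *\<^sub>R (y - x))" using that by (simp add: algebra_simps)
    then have "dist (x + R *\<^sub>R c) y = R * norm (c - (1 / R) *\<^sub>R (y - x))"
      using that by (simp add: dist_norm)
    also have "\<dots> < R * \<eta>" using c(2) that by simp
    finally have "y \<in> ball (x + R *\<^sub>R c) (\<eta> * R)" by (simp add: mult.commute)
    then show "y \<in> (\<Union>c\<in>D. ball (x + R *\<^sub>R c) (\<eta> * R))" using c(1) by blast
  qed
  with D(1) show ?thesis by (rule that)
qed

text \<open>Pigeonhole on a net of mesh \<eta> / 2. The bound \<open>M\<close> depends only on
  \<eta> and the space, not on the ball.\<close>

lemma close_pair_in_cball:
  fixes \<eta> :: real
  assumes "0 < \<eta>"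
  obtains M :: nat where "\<And>(X :: 'a::euclidean_space set) x R. \<lbrakk>M < card X; X \<subseteq> cball x R; 0 < R\<rbrakk>
    \<Longrightarrow> \<exists>p\<in>X. \<exists>q\<in>X. p \<noteq> q \<and> dist p q \<le> \<eta> * R"
proof -
  obtain D :: "'a set" where D: "finite D"
    "\<And>x R. 0 < R \<Longrightarrow> cball x R \<subseteq> (\<Union>c\<in>D. ball (x + R *\<^sub>R c) (\<eta> / 2 * R))"
    using finite_scaled_net[of "\<eta> / 2"] assms by (metis half_gt_zero)
  have "\<exists>p\<in>X. \<exists>q\<in>X. p \<noteq> q \<and> dist p q \<le> \<eta> * R"
    if X: "card D < card X" "X \<subseteq> cball x R" "0 < R" for X :: "'a set" and x R
  proof -
    have "\<forall>p\<in>X. \<exists>c. c \<in> D \<and> dist (x + R *\<^sub>R c) p < \<eta> / 2 * R"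
      using D(2)[OF X(3), of x] X(2) by (fastforce simp: subset_iff)
    then obtain f where f: "\<And>p. p \<in> X \<Longrightarrow> f p \<in> D \<and> dist (x + R *\<^sub>R f p) p < \<eta> / 2 * R"
      by metis
    have "card (f ` X) \<le> card D" using f D(1) by (intro card_mono) auto
    then have "\<not> inj_on f X" using X(1) by (intro pigeonhole) simp
    then obtain p q where pq: "p \<in> X" "q \<in> X" "p \<noteq> q" "f p = f q" by (auto simp: inj_on_def)
    have "dist p q \<le> dist (x + R *\<^sub>R f p) p + dist (x + R *\<^sub>R f p) q" by (metis dist_commute dist_triangle)
    also have "\<dots> \<le> \<eta> * R" using f[OF pq(1)] f[OF pq(2)] pq(4) by simp
    finally show ?thesis using pq by blast
  qed
  then show ?thesis by (rule that)
qed

text \<open>Volume comparison: the balls of radius 1/2 about the points are disjoint and lie in a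
  ball of radius \<open>R + 1 / 2\<close>.\<close>

lemma card_separated_cball:
  fixes P :: "'a::euclidean_space set"
  assumes "finite P" "separated P" "P \<subseteq> cball x R" "0 \<le> R"
  shows "real (card P) \<le> (2 * R + 1) ^ DIM('a)"
proof -
  have dis: "disjoint_family_on (\<lambda>p. ball p (1 / 2)) P"
  proof -
    have "ball p (1 / 2) \<inter> ball q (1 / 2) = {}" if "p \<in> P" "q \<in> P" "p \<noteq> q" for p q
    proof -
      have "1 \<le> dist p q" using assms(2) that by (simp add: separated_def)
      then show ?thesis using dist_triangle_half_r by (metis disjoint_ballI field_sum_of_halves)
    qed
    then show ?thesis by (auto simp: disjoint_family_on_def)
  qed
  let ?v = "unit_ball_vol (real DIM('a))"
  have sub: "(\<Union>p\<in>P. ball p (1 / 2)) \<subseteq> ball x (R + 1 / 2)"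
  proof
    fix y assume "y \<in> (\<Union>p\<in>P. ball p (1 / 2))"
    then obtain p where "p \<in> P" "dist p y < 1 / 2" by auto
    moreover have "dist x p \<le> R" using assms(3) \<open>p \<in> P\<close> by auto
    ultimately show "y \<in> ball x (R + 1 / 2)" using dist_triangle[of x y p] by simp
  qed
  have "card P * (?v * (1 / 2) ^ DIM('a)) = (\<Sum>p\<in>P. measure lborel (ball p (1 / 2)))"
    by (simp add: content_ball)
  also have "\<dots> = measure lborel (\<Union>p\<in>P. ball p (1 / 2))"
    using assms(1) dis by (intro measure_finite_Union[symmetric]) (auto simp: emeasure_ball)
  also have "\<dots> \<le> measure lborel (ball x (R + 1 / 2))"
    using sub by (intro measure_mono_fmeasurable) (auto simp: fmeasurable_def emeasure_ball assms(4) intro!: sets.finite_UN assms(1))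
  also have "\<dots> = ?v * (R + 1 / 2) ^ DIM('a)" using assms(4) by (simp add: content_ball)
  also have "\<dots> = ?v * ((2 * R + 1) * (1 / 2)) ^ DIM('a)" by (simp add: field_simps)
  also have "\<dots> = (2 * R + 1) ^ DIM('a) * (?v * (1 / 2) ^ DIM('a))"
    unfolding power_mult_distrib by simp
  finally show ?thesis by (simp add: mult_le_cancel_right)
qed

subsection \<open>The extremal quantities\<close>

text \<open>Induction on the number of intervals. With \<open>t i0\<close> the largest left
  endpoint, \<open>P\<close> lies in a ball of radius \<open>2 * t i0\<close>, which is covered by
  boundedly many balls of radius \<open>t i0 / 2\<close>. Distances within one of these are below
  \<open>t i0\<close>, so the interval of \<open>i0\<close> drops out. An arbitrary index set
  \<open>I\<close> allows any index to be deleted.\<close>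

lemma bounded_card_few_distances:
  "\<exists>B. \<forall>(P :: 'a::euclidean_space set) (t :: nat \<Rightarrow> real) (I :: nat set). finite P \<longrightarrow> finite I \<longrightarrow> card I = k \<longrightarrow>
     (\<forall>i\<in>I. 1 \<le> t i) \<longrightarrow>
     (\<forall>p\<in>P. \<forall>q\<in>P. p \<noteq> q \<longrightarrow> (\<exists>i\<in>I. t i \<le> dist p q \<and> dist p q \<le> t i + 1)) \<longrightarrow> card P \<le> B"
proof (induction k)
  case 0
  have "card P \<le> 1" if "finite P" "\<forall>p\<in>P. \<forall>q\<in>P. p = q" for P :: "'a set"
    using that by (metis card_le_Suc0_iff_eq One_nat_def)
  then show ?case by (intro exI[of _ 1]) auto
next
  case (Suc k)
  then obtain B where B: "\<And>(P :: 'a set) (t :: nat \<Rightarrow> real) (I :: nat set). \<lbrakk>finite P; finite I; card I = k;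
     \<forall>i\<in>I. 1 \<le> t i;
     \<forall>p\<in>P. \<forall>q\<in>P. p \<noteq> q \<longrightarrow> (\<exists>i\<in>I. t i \<le> dist p q \<and> dist p q \<le> t i + 1)\<rbrakk> \<Longrightarrow> card P \<le> B"
    by metis
  obtain D :: "'a set" where D: "finite D"
    "\<And>x R. 0 < R \<Longrightarrow> cball x R \<subseteq> (\<Union>c\<in>D. ball (x + R *\<^sub>R c) (1 / 4 * R))"
    using finite_scaled_net[of "1 / 4"] by (metis zero_less_divide_1_iff zero_less_numeral)
  have "card P \<le> card D * B" if P: "finite P" and I: "finite I" "card I = Suc k"
    and t: "\<forall>i\<in>I. 1 \<le> t i"
    and d: "\<forall>p\<in>P. \<forall>q\<in>P. p \<noteq> q \<longrightarrow> (\<exists>i\<in>I. t i \<le> dist p q \<and> dist p q \<le> t i + 1)"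
    for P :: "'a set" and t and I :: "nat set"
  proof (cases "P = {}")
    case False
    then obtain p0 where p0: "p0 \<in> P" by blast
    have "I \<noteq> {}" using I by auto
    then have "Max (t ` I) \<in> t ` I" using I by (intro Max_in) auto
    then obtain i0 where i0: "i0 \<in> I" "t i0 = Max (t ` I)" by auto
    have le: "t i \<le> t i0" if "i \<in> I" for i unfolding i0(2) using I that by simp
    have ti0: "1 \<le> t i0" using t i0 by blast
    let ?b = "\<lambda>c. ball (p0 + (2 * t i0) *\<^sub>R c) (1 / 4 * (2 * t i0))"
    have "P \<subseteq> cball p0 (2 * t i0)"
    proof
      fix q assume "q \<in> P"
      show "q \<in> cball p0 (2 * t i0)"
      proof (cases "q = p0")
        case True
        then show ?thesis using ti0 by simp
      next
        case False
        then obtain i where "i \<in> I" "dist p0 q \<le> t i + 1" using d p0 \<open>q \<in> P\<close> by metis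
        then show ?thesis using le[of i] ti0 by simp
      qed
    qed
    then have cov: "P \<subseteq> (\<Union>c\<in>D. ?b c)" using D(2)[of "2 * t i0" p0] ti0 by fastforce
    have "card (P \<inter> ?b c) \<le> B" for c
    proof (rule B[of _ "I - {i0}" t])
      show "\<forall>p\<in>P \<inter> ?b c. \<forall>q\<in>P \<inter> ?b c. p \<noteq> q \<longrightarrow>
        (\<exists>i\<in>I - {i0}. t i \<le> dist p q \<and> dist p q \<le> t i + 1)"
      proof (intro ballI impI)
        fix p q assume p: "p \<in> P \<inter> ?b c" and q: "q \<in> P \<inter> ?b c" and "p \<noteq> q"
        then obtain i where i: "i \<in> I" "t i \<le> dist p q" "dist p q \<le> t i + 1" using d by blast
        let ?c = "p0 + (2 * t i0) *\<^sub>R c"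
        have "dist p q \<le> dist ?c p + dist ?c q" by (metis dist_commute dist_triangle)
        also have "\<dots> < t i0" using p q by simp
        finally have "i \<noteq> i0" using i by auto
        then show "\<exists>i\<in>I - {i0}. t i \<le> dist p q \<and> dist p q \<le> t i + 1" using i by blast
      qed
    qed (use P I t i0 in auto)
    then have "(\<Sum>c\<in>D. card (P \<inter> ?b c)) \<le> (\<Sum>c\<in>D. B)" by (intro sum_mono)
    moreover have "card P \<le> (\<Sum>c\<in>D. card (P \<inter> ?b c))"
    proof -
      have "P = (\<Union>c\<in>D. P \<inter> ?b c)" using cov by blast
      then show ?thesis using card_UN_le[OF D(1), of "\<lambda>c. P \<inter> ?b c"] by presburger
    qed
    ultimately show ?thesis by simp
  qed simp
  then show ?case by blast
qed

lemma bounded_card_nearly_k_distance: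
  "\<exists>B. \<forall>P :: 'a::euclidean_space set. finite P \<longrightarrow> nearly_k_distance k 1 P \<longrightarrow> card P \<le> B"
proof -
  obtain B where B: "\<And>(P :: 'a set) (t :: nat \<Rightarrow> real) (I :: nat set). \<lbrakk>finite P; finite I; card I = k;
     \<forall>i\<in>I. 1 \<le> t i;
     \<forall>p\<in>P. \<forall>q\<in>P. p \<noteq> q \<longrightarrow> (\<exists>i\<in>I. t i \<le> dist p q \<and> dist p q \<le> t i + 1)\<rbrakk> \<Longrightarrow> card P \<le> B"
    using bounded_card_few_distances[of k] by metis
  have "card P \<le> B" if P: "finite P" "nearly_k_distance k 1 P" for P :: "'a set"
  proof -
    obtain t :: "nat \<Rightarrow> real" where t: "1 \<le> t 0" "\<forall>i. Suc i < k \<longrightarrow> t i < t (Suc i)"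
        "\<forall>p\<in>P. \<forall>q\<in>P. p \<noteq> q \<longrightarrow> (\<exists>i<k. t i \<le> dist p q \<and> dist p q \<le> t i + 1)"
      using P(2) unfolding nearly_k_distance_def by blast
    have "i < k \<Longrightarrow> 1 \<le> t i" for i
    proof (induction i)
      case (Suc i)
      then show ?case using t(2) by force
    qed (use t in simp)
    then show ?thesis using t(3) by (intro B[OF P(1), of "{..<k}" t]) (auto simp: Bex_def)
  qed
  then show ?thesis by blast
qed

text \<open>The cardinality bound for \<epsilon> = 1 bounds the candidates in \<open>Nk\<close>, so
  its \<open>GREATEST\<close> is a genuine upper bound and its successor fails for some \<epsilon>
  and \<alpha>.\<close>

lemma ex_no_flat_nearly_k_distance:
  "\<exists>\<epsilon>>0. \<exists>\<alpha>>0. \<not> (\<exists>P :: 'a::euclidean_space set.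
     finite P \<and> card P = Suc (Nk k TYPE('a)) \<and> flat \<alpha> P \<and> nearly_k_distance k \<epsilon> P)"
proof (rule ccontr)
  let ?Q = "\<lambda>N. \<forall>\<epsilon>>0. \<forall>\<alpha>>0. \<exists>P :: 'a set.
      finite P \<and> card P = N \<and> flat \<alpha> P \<and> nearly_k_distance k \<epsilon> P"
  assume "\<not> ?thesis"
  then have Q: "?Q (Suc (Nk k TYPE('a)))" by blast
  obtain B where B: "\<And>P :: 'a set. finite P \<Longrightarrow> nearly_k_distance k 1 P \<Longrightarrow> card P \<le> B"
    using bounded_card_nearly_k_distance by metis
  have "N \<le> B" if "?Q N" for N
    using that[THEN spec, of 1] B by (metis zero_less_one)
  from Greatest_le_nat[of ?Q, OF Q this] show False unfolding Nk_def by simp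
qed

lemma good_pairs_subset_image: "good_pairs k w t S \<subseteq> (\<lambda>(p, q). {p, q}) ` (S \<times> S)"
  by (force simp: good_pairs_def)

lemma finite_good_pairs: "finite S \<Longrightarrow> finite (good_pairs k w t S)"
  by (rule finite_subset[OF good_pairs_subset_image]) simp

lemma good_pairs_mono: "w \<le> w' \<Longrightarrow> good_pairs k w t S \<subseteq> good_pairs k w' t S"
  unfolding good_pairs_def by force

text \<open>Equally spaced points on a line; they show that the set whose greatest element defines
  \<open>Mw\<close> is non-empty.\<close>

lemma ex_separated_card:
  "\<exists>S :: 'a::euclidean_space set. finite S \<and> card S = n \<and> separated S"
proof -
  obtain b :: 'a where b: "b \<in> Basis" using nonempty_Basis by blast
  let ?f = "\<lambda>i::nat. real i *\<^sub>R b"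
  have d: "dist (?f i) (?f j) = \<bar>real i - real j\<bar>" for i j
    using norm_Basis[OF b] by (simp add: dist_norm flip: scaleR_left_diff_distrib)
  have "inj ?f" using b by (auto simp: inj_on_def nonzero_Basis)
  then show ?thesis
    by (intro exI[of _ "?f ` {..<n}"]) (auto simp: card_image inj_on_subset separated_def d simp del: dist_scaleR)
qed

text \<open>The candidates in \<open>Mw\<close> are bounded by \<open>n * n\<close> and include 0,
  so the greatest one is attained by some configuration, to which the uniform bound applies.\<close>

lemma Mw_le:
  assumes "\<And>(S :: 'a::euclidean_space set) t. \<lbrakk>finite S; card S = n; separated S; 1 \<le> t 0;
      \<forall>i. Suc i < k \<longrightarrow> t i \<le> t (Suc i)\<rbrakk> \<Longrightarrow> real (card (good_pairs k w t S)) \<le> b"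
  shows "real (Mw k w n TYPE('a)) \<le> b"
proof -
  let ?Q = "\<lambda>M. \<exists>(S :: 'a set) (t :: nat \<Rightarrow> real).
      finite S \<and> card S = n \<and> separated S \<and>
      1 \<le> t 0 \<and> (\<forall>i. Suc i < k \<longrightarrow> t i \<le> t (Suc i)) \<and>
      card (good_pairs k w t S) \<ge> M"
  obtain S :: "'a set" where "finite S" "card S = n" "separated S" using ex_separated_card by blast
  then have ex: "\<exists>M. ?Q M" by (intro exI[of _ 0] exI[of _ S] exI[of _ "\<lambda>_. 1"]) simp
  have bd: "M \<le> n * n" if "?Q M" for M
  proof -
    from that obtain S :: "'a set" and t where S: "finite S" "card S = n" "M \<le> card (good_pairs k w t S)"
      by blast
    have "card (good_pairs k w t S) \<le> card ((\<lambda>(p, q). {p, q}) ` (S \<times> S))"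
      using S(1) by (intro card_mono good_pairs_subset_image) auto
    also have "\<dots> \<le> card (S \<times> S)" using S(1) by (intro card_image_le) auto
    also have "\<dots> = n * n" using S by (simp add: card_cartesian_product)
    finally show ?thesis using S by simp
  qed
  have "?Q (Mw k w n TYPE('a))" unfolding Mw_def by (rule GreatestI_ex_nat[OF ex bd])
  then obtain S :: "'a set" and t where S: "finite S" "card S = n" "separated S" "1 \<le> t 0"
      "\<forall>i. Suc i < k \<longrightarrow> t i \<le> t (Suc i)" and M: "Mw k w n TYPE('a) \<le> card (good_pairs k w t S)"
    by blast
  have "real (Mw k w n TYPE('a)) \<le> card (good_pairs k w t S)" using M by simp
  also have "\<dots> \<le> b" using S by (rule assms)
  finally show ?thesis .
qed

text \<open>Each unordered pair comes from two ordered ones. The passage to ordered pairs matches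
  the edge counts of the graph lemmas.\<close>

lemma card_good_pairs_le:
  fixes S :: "'a::euclidean_space set"
  assumes "finite S"
  shows "2 * card (good_pairs k w t S) \<le>
    card {(p, q) \<in> S \<times> S. p \<noteq> q \<and> (\<exists>i<k. t i \<le> dist p q \<and> dist p q \<le> t i + w)}" (is "_ \<le> card ?O")
proof -
  have fin: "finite ?O" by (rule finite_subset[of _ "S \<times> S"]) (use assms in auto)
  let ?f = "\<lambda>(p, q). {p, q}"
  have img: "?f ` ?O = good_pairs k w t S" by (force simp: good_pairs_def)
  have "2 * card (good_pairs k w t S) = (\<Sum>e\<in>?f ` ?O. 2)" unfolding img by simp
  also have "\<dots> \<le> (\<Sum>e\<in>?f ` ?O. card {z\<in>?O. ?f z = e})"
  proof (rule sum_mono)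
    fix e assume "e \<in> ?f ` ?O"
    then obtain p q where pq: "(p, q) \<in> ?O" "e = {p, q}" by auto
    then have "{(p, q), (q, p)} \<subseteq> {z\<in>?O. ?f z = e}" by (auto simp: dist_commute)
    then have "card {(p, q), (q, p)} \<le> card {z\<in>?O. ?f z = e}" using fin by (intro card_mono) auto
    then show "2 \<le> card {z\<in>?O. ?f z = e}" using pq by auto
  qed
  also have "\<dots> = card ?O" using sum.image_gen[OF fin, of "\<lambda>_. 1::nat" ?f] by simp
  finally show ?thesis .
qed

subsection \<open>Flat configurations from twins\<close>

text \<open>The projection \<open>w\<close> of \<open>v\<close> to the hyperplane orthogonal to
  \<open>u\<close> has norm at least \<open>cos \<alpha> * norm v\<close>, and the angle between
  \<open>v\<close> and \<open>w\<close> is \<open>arccos (norm w / norm v)\<close>. This angle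
  bounds the infimum from above.\<close>

lemma angle_plane_le:
  fixes u v :: "'a::euclidean_space"
  assumes "u \<noteq> 0" "v \<noteq> 0" "0 \<le> \<alpha>" "\<alpha> < pi / 2" and le: "\<bar>v \<bullet> u\<bar> \<le> sin \<alpha> * (norm v * norm u)"
  shows "angle_plane v {x. u \<bullet> x = 0} \<le> \<alpha>"
proof -
  define w where "w = v - ((v \<bullet> u) / (u \<bullet> u)) *\<^sub>R u"
  have uw: "u \<bullet> w = 0" using assms(1) by (simp add: w_def inner_diff_right inner_commute)
  have "v \<bullet> w = (w + ((v \<bullet> u) / (u \<bullet> u)) *\<^sub>R u) \<bullet> w" by (simp add: w_def)
  then have vw: "v \<bullet> w = (norm w)\<^sup>2" using uw by (simp add: inner_add_left power2_norm_eq_inner)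
  have "(norm w)\<^sup>2 = (norm v)\<^sup>2 - (v \<bullet> u)\<^sup>2 / (norm u)\<^sup>2"
    unfolding vw[symmetric] using assms(1) by (simp add: w_def inner_diff_right dot_square_norm power2_eq_square[of "v \<bullet> u"])
  moreover have "(v \<bullet> u)\<^sup>2 / (norm u)\<^sup>2 \<le> (sin \<alpha>)\<^sup>2 * (norm v)\<^sup>2"
  proof -
    have "(v \<bullet> u)\<^sup>2 \<le> (sin \<alpha> * (norm v * norm u))\<^sup>2" using power_mono[OF le, of 2] by simp
    then show ?thesis using assms(1) by (simp add: power_mult_distrib field_simps)
  qed
  ultimately have "(norm w)\<^sup>2 \<ge> (1 - (sin \<alpha>)\<^sup>2) * (norm v)\<^sup>2" by (simp add: algebra_simps)
  then have "(norm w)\<^sup>2 \<ge> (cos \<alpha> * norm v)\<^sup>2" by (simp add: power_mult_distrib cos_squared_eq)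
  then have nw: "cos \<alpha> * norm v \<le> norm w" using power2_le_imp_le norm_ge_zero by blast
  have cpos: "0 < cos \<alpha>" using assms by (intro cos_gt_zero_pi) auto
  have "0 < cos \<alpha> * norm v" using cpos assms(2) by simp
  then have w0: "w \<noteq> 0" using nw by auto
  have lb: "-1 \<le> (v \<bullet> z) / (norm v * norm z) \<and> (v \<bullet> z) / (norm v * norm z) \<le> 1" for z
  proof -
    have "\<bar>(v \<bullet> z) / (norm v * norm z)\<bar> \<le> 1"
      using Cauchy_Schwarz_ineq2[of v z] by (auto simp: abs_divide divide_le_eq_1)
    then show ?thesis by linarith
  qed
  let ?A = "{vec_angle v z | z. z \<in> {x - y | x y. x \<in> {x. u \<bullet> x = 0} \<and> y \<in> {x. u \<bullet> x = 0}} \<and> z \<noteq> 0}"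
  have "bdd_below ?A"
    by (rule bdd_belowI[of _ 0]) (auto simp: vec_angle_def intro!: arccos_lbound lb[THEN conjunct1] lb[THEN conjunct2])
  moreover have "vec_angle v w \<in> ?A"
  proof -
    have "w = w - 0" "u \<bullet> w = 0" "u \<bullet> 0 = 0" using uw by auto
    then show ?thesis using w0 by blast
  qed
  ultimately have "angle_plane v {x. u \<bullet> x = 0} \<le> vec_angle v w"
    unfolding angle_plane_def by (rule cInf_lower[rotated])
  also have "vec_angle v w = arccos (norm w / norm v)"
    using w0 by (simp add: vec_angle_def vw power2_eq_square)
  also have "\<dots> \<le> arccos (cos \<alpha>)"
  proof (rule arccos_le_arccos)
    show "-1 \<le> cos \<alpha>" by simp
    show "cos \<alpha> \<le> norm w / norm v" using nw assms(2) by (simp add: field_simps)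
    show "norm w / norm v \<le> 1" using lb[of w] w0 by (simp add: vw power2_eq_square)
  qed
  also have "\<dots> = \<alpha>" using assms by (intro arccos_cos) auto
  finally show ?thesis .
qed

text \<open>Expanding the square of \<open>dist p' q\<close> expresses the inner product through a
  difference of squares, whose factors are at most \<open>w\<close> and \<open>3 * dist p q\<close>
  in absolute value.\<close>

lemma near_orthogonal:
  fixes p p' q :: "'a::real_inner"
  assumes "\<bar>dist p q - dist p' q\<bar> \<le> w" "w \<le> dist p q"
  shows "2 * \<bar>(p - q) \<bullet> (p - p')\<bar> \<le> 3 * w * dist p q + (dist p p')\<^sup>2"
proof -
  let ?D = "dist p q" and ?D' = "dist p' q"
  have "?D'\<^sup>2 = ((p - q) - (p - p')) \<bullet> ((p - q) - (p - p'))"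
    by (simp add: dist_norm power2_norm_eq_inner)
  also have "\<dots> = ?D\<^sup>2 - 2 * ((p - q) \<bullet> (p - p')) + (dist p p')\<^sup>2"
    unfolding dist_norm power2_norm_eq_inner
    by (simp only: inner_diff_left inner_diff_right inner_commute) (simp add: algebra_simps)
  finally have "2 * ((p - q) \<bullet> (p - p')) = (?D - ?D') * (?D + ?D') + (dist p p')\<^sup>2"
    by (simp add: power2_eq_square algebra_simps)
  then have "2 * \<bar>(p - q) \<bullet> (p - p')\<bar> \<le> \<bar>(?D - ?D') * (?D + ?D')\<bar> + (dist p p')\<^sup>2"
    by (smt (verit) zero_le_power2)
  also have "\<bar>(?D - ?D') * (?D + ?D')\<bar> \<le> w * (3 * ?D)"
    unfolding abs_mult using assms by (intro mult_mono) auto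
  finally show ?thesis by (simp add: algebra_simps)
qed

text \<open>The witnessing hyperplane at the scaled point of \<open>p j\<close> is orthogonal to
  \<open>p j - p' j\<close>. The twins serve only to define these hyperplanes; the set consists of
  the scaled points \<open>p j\<close>.\<close>

lemma flat_nearly_k_distance_of_twins:
  fixes p p' :: "nat \<Rightarrow> 'a::euclidean_space" and t :: "nat \<Rightarrow> real"
  assumes "0 < \<epsilon>" "0 < \<alpha>" "\<alpha> < pi / 2" "0 < w" "1 \<le> K" "3 / sin \<alpha> \<le> K" "4 / \<epsilon> \<le> K"
    and t: "\<forall>i. Suc i < k \<longrightarrow> t i \<le> t (Suc i)"
    and twin: "\<And>j. j < n \<Longrightarrow> K * w < dist (p j) (p' j)"
    and far: "\<And>j l. \<lbrakk>j < n; l < n; j \<noteq> l\<rbrakk> \<Longrightarrow> K * w < dist (p j) (p l)"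
    and close: "\<And>j l. \<lbrakk>j < n; l < n; j \<noteq> l\<rbrakk> \<Longrightarrow> dist (p j) (p' j) \<le> sin \<alpha> / 2 * dist (p j) (p l)"
    and d: "\<And>j l. \<lbrakk>j < n; l < n; j \<noteq> l\<rbrakk> \<Longrightarrow>
      \<exists>c<k. {dist (p j) (p l), dist (p' j) (p l)} \<subseteq> {t c..t c + w}"
  shows "\<exists>P :: 'a set. finite P \<and> card P = n \<and> flat \<alpha> P \<and> nearly_k_distance k \<epsilon> P"
proof -
  \<comment> \<open>Scaling by 1 / \<rho> shrinks the intervals to length \<open>2 / K\<close>, at
    most \<epsilon> / 2, and makes all distances exceed 2.\<close>
  define \<rho> where "\<rho> = K * w / 2"
  have \<rho>: "0 < \<rho>" using assms by (simp add: \<rho>_def)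
  define x where "x j = (1 / \<rho>) *\<^sub>R p j" for j
  have dx: "dist (x j) (x l) = dist (p j) (p l) / \<rho>" for j l
    using \<rho> by (simp add: x_def dist_norm flip: scaleR_right_diff_distrib)
  have dx2: "2 < dist (x j) (x l)" if "j < n" "l < n" "j \<noteq> l" for j l
    using far[OF that] \<rho> by (simp add: dx \<rho>_def field_simps)
  define P where "P = x ` {..<n}"
  have inj: "inj_on x {..<n}"
  proof (rule inj_onI, rule ccontr)
    fix j l assume "j \<in> {..<n}" "l \<in> {..<n}" "x j = x l" "j \<noteq> l"
    then show False using dx2[of j l] by simp
  qed
  have pos: "0 < sin \<alpha>" using assms by (intro sin_gt_zero) auto
  have "flat \<alpha> P" unfolding flat_def
  proof
    fix y assume "y \<in> P"
    then obtain j where j: "j < n" "y = x j" by (auto simp: P_def)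
    define u where "u = p j - p' j"
    have nu: "norm u = dist (p j) (p' j)" by (simp add: u_def dist_norm)
    have "0 < K * w" using assms by simp
    then have "0 < norm u" using twin[OF j(1)] unfolding nu by linarith
    then have u0: "u \<noteq> 0" by simp
    have "angle_plane (y - z) {v. u \<bullet> v = 0} \<le> \<alpha>" if z: "z \<in> P" "z \<noteq> y" for z
    proof (rule angle_plane_le)
      obtain l where l: "l < n" "z = x l" using z(1) by (auto simp: P_def)
      have jl: "j \<noteq> l" using z l j by auto
      let ?D = "dist (p j) (p l)" and ?\<delta> = "dist (p j) (p' j)"
      obtain c where c: "{?D, dist (p' j) (p l)} \<subseteq> {t c..t c + w}" using d[OF j(1) l(1) jl] by blast
      have "w \<le> K * w" using assms by simp
      then have wD: "w \<le> ?D" using far[OF j(1) l(1) jl] by simp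
      \<comment> \<open>The first term is small because the twins are far apart compared with
        \<open>w\<close>, the second because they are close compared with \<open>?D\<close>.
        Together they give 3/4 of the permitted bound.\<close>
      have "2 * \<bar>(p j - p l) \<bullet> u\<bar> \<le> 3 * w * ?D + ?\<delta>\<^sup>2"
        unfolding u_def by (rule near_orthogonal) (use c wD in auto)
      also have "3 * w \<le> sin \<alpha> * ?\<delta>"
      proof -
        have "3 * w \<le> sin \<alpha> * K * w" using assms pos by (simp add: field_simps)
        also have "\<dots> \<le> sin \<alpha> * ?\<delta>" using twin[OF j(1)] pos by (simp add: mult.assoc)
        finally show ?thesis .
      qed
      then have "3 * w * ?D \<le> sin \<alpha> * ?\<delta> * ?D" by (rule mult_right_mono) simp
      also have "?\<delta>\<^sup>2 \<le> ?\<delta> * (sin \<alpha> / 2 * ?D)"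
        unfolding power2_eq_square using close[OF j(1) l(1) jl] by (intro mult_left_mono) auto
      finally have "2 * \<bar>(p j - p l) \<bullet> u\<bar> \<le> 3 / 2 * (sin \<alpha> * (?D * ?\<delta>))" by (simp add: algebra_simps)
      moreover have "0 \<le> sin \<alpha> * (?D * ?\<delta>)" using pos by simp
      ultimately have main: "\<bar>(p j - p l) \<bullet> u\<bar> \<le> sin \<alpha> * (?D * ?\<delta>)" by linarith
      have yz: "y - z = (1 / \<rho>) *\<^sub>R (p j - p l)" by (simp add: j l x_def scaleR_right_diff_distrib)
      have "\<bar>(y - z) \<bullet> u\<bar> = \<bar>(p j - p l) \<bullet> u\<bar> / \<rho>" using \<rho> by (simp add: yz abs_mult)
      also have "\<dots> \<le> sin \<alpha> * (?D * ?\<delta>) / \<rho>" using main \<rho> by (simp add: divide_right_mono)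
      also have "\<dots> = sin \<alpha> * (norm (y - z) * norm u)" using \<rho> by (simp add: yz nu dist_norm)
      finally show "\<bar>(y - z) \<bullet> u\<bar> \<le> sin \<alpha> * (norm (y - z) * norm u)" .
    qed (use z u0 assms in auto)
    moreover have "hyperplane {v. u \<bullet> v = 0}"
      using u0 by (simp add: hyperplane_def affine_hyperplane of_nat_diff)
    ultimately show "\<exists>\<Lambda>. flat_at y \<alpha> \<Lambda> P" unfolding flat_at_def by blast
  qed
  moreover have "nearly_k_distance k \<epsilon> P"
  proof -
    define \<delta> where "\<delta> = min 1 (\<epsilon> / 2)"
    have \<delta>: "0 < \<delta>" "\<delta> \<le> 1" "\<delta> \<le> \<epsilon> / 2" using assms by (auto simp: \<delta>_def)
    \<comment> \<open>The \<open>t i\<close> may coincide, while strictly increasing endpoints at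
      least 1 are required. Raising them to 2 loses nothing, as all distances exceed 2. Subtracting
      a strictly decreasing shift of at most \<delta> then separates them, at the cost of the other
      half of \<epsilon>.\<close>
    define s where "s i = max 2 (t i / \<rho>) - \<delta> * ((real k - real i) / real k)" for i
    have slack: "0 \<le> \<delta> * ((real k - real i) / real k)" "\<delta> * ((real k - real i) / real k) \<le> \<delta>" if "i < k" for i
    proof -
      show "0 \<le> \<delta> * ((real k - real i) / real k)" using that \<delta> by simp
      have "(real k - real i) / real k \<le> 1" using that by simp
      then have "\<delta> * ((real k - real i) / real k) \<le> \<delta> * 1" using \<delta> by (intro mult_left_mono) auto
      then show "\<delta> * ((real k - real i) / real k) \<le> \<delta>" by simp
    qed
    have w\<rho>: "w / \<rho> \<le> \<epsilon> / 2" using assms by (simp add: \<rho>_def field_simps)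
    have "1 \<le> s 0"
    proof (cases "k = 0")
      case False
      then show ?thesis using \<delta> by (simp add: s_def max_def)
    qed (simp add: s_def)
    moreover have "s i < s (Suc i)" if "Suc i < k" for i
    proof -
      have "t i / \<rho> \<le> t (Suc i) / \<rho>" using t that \<rho> by (simp add: divide_right_mono)
      moreover have "\<delta> * ((real k - real (Suc i)) / real k) < \<delta> * ((real k - real i) / real k)"
        using that \<delta> by (intro mult_strict_left_mono divide_strict_right_mono) auto
      ultimately show ?thesis unfolding s_def by (simp add: max_def)
    qed
    moreover have "\<exists>i<k. s i \<le> dist y z \<and> dist y z \<le> s i + \<epsilon>"
      if yz: "y \<in> P" "z \<in> P" "y \<noteq> z" for y z
    proof -
      obtain j l where jl: "j < n" "y = x j" "l < n" "z = x l" using yz by (auto simp: P_def)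
      then have ne: "j \<noteq> l" using yz by auto
      obtain c where c: "c < k" "{dist (p j) (p l), dist (p' j) (p l)} \<subseteq> {t c..t c + w}"
        using d[OF jl(1) jl(3) ne] by blast
      have "t c / \<rho> \<le> dist y z" using c \<rho> by (simp add: jl dx divide_right_mono)
      moreover have "dist y z \<le> t c / \<rho> + w / \<rho>"
        using c \<rho> by (simp add: jl dx divide_right_mono flip: add_divide_distrib)
      moreover have "2 < dist y z" using dx2 jl ne by simp
      ultimately have "s c \<le> dist y z \<and> dist y z \<le> s c + \<epsilon>"
        using slack[OF c(1)] \<delta> w\<rho> unfolding s_def by linarith
      then show ?thesis using c(1) by blast
    qed
    moreover have "separated P" unfolding separated_def
    proof (intro ballI impI)
      fix y z assume "y \<in> P" "z \<in> P" "y \<noteq> z"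
      then obtain j l where "j < n" "y = x j" "l < n" "z = x l" "j \<noteq> l" by (auto simp: P_def)
      then show "1 \<le> dist y z" using dx2[of j l] by simp
    qed
    ultimately show ?thesis unfolding nearly_k_distance_def by blast
  qed
  moreover have "finite P" "card P = n" using inj by (simp_all add: P_def card_image)
  ultimately show ?thesis by blast
qed

text \<open>All points of a part lie in a ball whose radius is comparable to the distance to the nearest
  other part, so two of them are much closer to each other than to the other parts.\<close>
lemma ex_twin_in_part:
  fixes W :: "nat \<Rightarrow> 'a::euclidean_space set" and t :: "nat \<Rightarrow> real"
  assumes M: "\<And>(X :: 'a set) x R. \<lbrakk>M < card X; X \<subseteq> cball x R; 0 < R\<rbrakk>
      \<Longrightarrow> \<exists>p\<in>X. \<exists>q\<in>X. p \<noteq> q \<and> dist p q \<le> \<eta> * R"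
    and "0 < \<eta>" "0 < w" "1 \<le> K" "2 \<le> n" "j < n"
    and parts: "homogeneous_parts k (\<lambda>c x y. t c \<le> dist x y \<and> dist x y \<le> t c + w \<and> K * w < dist x y)
      (\<lambda>x y. dist x y \<le> K * w) V n (Suc M) W"
  shows "\<exists>p\<in>W j. \<exists>p'\<in>W j. K * w < dist p p' \<and>
    (\<forall>l<n. l \<noteq> j \<longrightarrow> (\<forall>q\<in>W l. dist p p' \<le> 2 * \<eta> * dist p q))"
proof -
  have card: "card (W i) = Suc M" if "i < n" for i using parts that unfolding homogeneous_parts_def by blast
  have sparse: "K * w < dist x y" if "x \<in> W j" "y \<in> W j" "x \<noteq> y" for x y
    using parts that \<open>j < n\<close> unfolding homogeneous_parts_def by (meson not_le)
  have ex: "\<exists>c<k. \<forall>x\<in>W j. \<forall>y\<in>W l. t c \<le> dist x y \<and> dist x y \<le> t c + w \<and> K * w < dist x y"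
    if "l < n" "l \<noteq> j" for l
    using parts that \<open>j < n\<close> unfolding homogeneous_parts_def by blast
  define L where "L = {..<n} - {j}"
  have "\<forall>l\<in>L. \<exists>c. \<forall>x\<in>W j. \<forall>y\<in>W l. t c \<le> dist x y \<and> dist x y \<le> t c + w \<and> K * w < dist x y"
    using ex unfolding L_def by blast
  then obtain col where col: "\<And>l x y. \<lbrakk>l \<in> L; x \<in> W j; y \<in> W l\<rbrakk> \<Longrightarrow>
      t (col l) \<le> dist x y \<and> dist x y \<le> t (col l) + w \<and> K * w < dist x y"
    by (metis (no_types, lifting))
  have "card L = n - 1" using \<open>j < n\<close> by (simp add: L_def)
  then have "0 < card L" using \<open>2 \<le> n\<close> by simp
  then have L: "finite L" "L \<noteq> {}" by (auto simp only: card_gt_0_iff)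
  \<comment> \<open>\<open>l0\<close> is the nearest other part, measured by the left endpoint of
    its interval. One point \<open>q0\<close> of it is the centre of a ball containing all of
    \<open>W j\<close>.\<close>
  have "Min ((t \<circ> col) ` L) \<in> (t \<circ> col) ` L" using L by (intro Min_in) auto
  then obtain l0 where l0: "l0 \<in> L" "t (col l0) = Min ((t \<circ> col) ` L)" by auto
  have min: "t (col l0) \<le> t (col l)" if "l \<in> L" for l
    unfolding l0(2) using L(1) that by (intro Min_le) auto
  have "l0 < n" using l0 by (simp add: L_def)
  then obtain q0 where q0: "q0 \<in> W l0" using card by (metis card.empty equals0I nat.distinct(1))
  obtain x0 where x0: "x0 \<in> W j" using card[OF \<open>j < n\<close>] by (metis card.empty equals0I nat.distinct(1))
  define R where "R = t (col l0) + w"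
  have "0 < K * w" using assms by simp
  then have R: "0 < R" using col[OF l0(1) x0 q0] by (simp add: R_def)
  have "W j \<subseteq> cball q0 R"
  proof
    fix x assume "x \<in> W j"
    then show "x \<in> cball q0 R" using col[OF l0(1) _ q0, of x] by (simp add: R_def dist_commute)
  qed
  then obtain p p' where p: "p \<in> W j" "p' \<in> W j" "p \<noteq> p'" "dist p p' \<le> \<eta> * R"
    using M[of "W j" q0 R] R card[OF \<open>j < n\<close>] by auto
  have "dist p p' \<le> 2 * \<eta> * dist p q" if "l < n" "l \<noteq> j" "q \<in> W l" for l q
  proof -
    have lL: "l \<in> L" using that by (simp add: L_def)
    have "w \<le> K * w" using assms by simp
    \<comment> \<open>Both summands of \<open>R\<close> are at most \<open>dist p q\<close>: the
      endpoint by minimality of \<open>l0\<close>, and \<open>w\<close> because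
      \<open>w \<le> K * w < dist p q\<close>.\<close>
    then have "R \<le> 2 * dist p q" using col[OF lL p(1) that(3)] min[OF lL] by (simp add: R_def)
    then have "\<eta> * R \<le> \<eta> * (2 * dist p q)" using \<open>0 < \<eta>\<close> by (intro mult_left_mono) auto
    then show ?thesis using p(4) by simp
  qed
  then show ?thesis using p sparse[OF p(1,2,3)] by blast
qed

text \<open>Choosing twins in each part reduces this to the previous construction. It matters that
  \<open>K\<close> and \<open>m\<close> depend only on \<epsilon>, \<alpha>, \<open>n\<close> and
  the space: the interval length \<open>w\<close> is fixed after them.\<close>

lemma flat_nearly_k_distance_of_parts:
  fixes \<epsilon> \<alpha> :: real
  assumes "0 < \<epsilon>" "0 < \<alpha>" "2 \<le> n"
  obtains K :: real and m :: nat where "1 \<le> K"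
    "\<And>k w (t :: nat \<Rightarrow> real) (V :: 'a::euclidean_space set) W. \<lbrakk>0 < w; \<forall>i. Suc i < k \<longrightarrow> t i \<le> t (Suc i);
      homogeneous_parts k (\<lambda>c x y. t c \<le> dist x y \<and> dist x y \<le> t c + w \<and> K * w < dist x y)
        (\<lambda>x y. dist x y \<le> K * w) V n m W\<rbrakk>
      \<Longrightarrow> \<exists>P :: 'a set. finite P \<and> card P = n \<and> flat \<alpha> P \<and> nearly_k_distance k \<epsilon> P"
proof -
  \<comment> \<open>The projection argument needs an angle below \<open>pi / 2\<close>; flatness for
    \<beta> implies flatness for the larger \<alpha>.\<close>
  define \<beta> where "\<beta> = min \<alpha> 1"
  have \<beta>: "0 < \<beta>" "\<beta> < pi / 2" "\<beta> \<le> \<alpha>" using assms pi_gt3 by (auto simp: \<beta>_def min_def)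
  have pos: "0 < sin \<beta>" using \<beta> by (intro sin_gt_zero) auto
  define K where "K = 1 + 3 / sin \<beta> + 4 / \<epsilon>"
  have K: "1 \<le> K" "3 / sin \<beta> \<le> K" "4 / \<epsilon> \<le> K" using pos assms by (auto simp: K_def)
  \<comment> \<open>The factor \<open>sin \<beta> / 4\<close> is doubled by the choice of twins and
    then gives the required closeness \<open>sin \<beta> / 2\<close>.\<close>
  obtain M :: nat where M: "\<And>(X :: 'a set) x R. \<lbrakk>M < card X; X \<subseteq> cball x R; 0 < R\<rbrakk>
    \<Longrightarrow> \<exists>p\<in>X. \<exists>q\<in>X. p \<noteq> q \<and> dist p q \<le> sin \<beta> / 4 * R"
    using close_pair_in_cball[of "sin \<beta> / 4"] pos by (metis zero_less_divide_iff zero_less_numeral)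
  show ?thesis
  proof (rule that[OF K(1), of "Suc M"])
    fix k w and t :: "nat \<Rightarrow> real" and V :: "'a set" and W
    assume w: "0 < w" and t: "\<forall>i. Suc i < k \<longrightarrow> t i \<le> t (Suc i)"
      and parts: "homogeneous_parts k (\<lambda>c x y. t c \<le> dist x y \<and> dist x y \<le> t c + w \<and> K * w < dist x y)
        (\<lambda>x y. dist x y \<le> K * w) V n (Suc M) W"
    have "\<forall>j\<in>{..<n}. \<exists>z. fst z \<in> W j \<and> snd z \<in> W j \<and> K * w < dist (fst z) (snd z) \<and>
      (\<forall>l<n. l \<noteq> j \<longrightarrow> (\<forall>q\<in>W l. dist (fst z) (snd z) \<le> 2 * (sin \<beta> / 4) * dist (fst z) q))"
    proof
      fix j assume "j \<in> {..<n}"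
      then have "j < n" by simp
      have "0 < sin \<beta> / 4" using pos by simp
      have "\<exists>p\<in>W j. \<exists>p'\<in>W j. K * w < dist p p' \<and>
        (\<forall>l<n. l \<noteq> j \<longrightarrow> (\<forall>q\<in>W l. dist p p' \<le> 2 * (sin \<beta> / 4) * dist p q))"
        by (rule ex_twin_in_part[OF _ \<open>0 < sin \<beta> / 4\<close> w K(1) \<open>2 \<le> n\<close> \<open>j < n\<close> parts]) (rule M)
      then show "\<exists>z. fst z \<in> W j \<and> snd z \<in> W j \<and> K * w < dist (fst z) (snd z) \<and>
        (\<forall>l<n. l \<noteq> j \<longrightarrow> (\<forall>q\<in>W l. dist (fst z) (snd z) \<le> 2 * (sin \<beta> / 4) * dist (fst z) q))"
        by (metis fst_conv snd_conv)
    qed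
    from bchoice[OF this] obtain z where z: "\<And>j. j < n \<Longrightarrow> fst (z j) \<in> W j \<and> snd (z j) \<in> W j \<and>
      K * w < dist (fst (z j)) (snd (z j)) \<and>
      (\<forall>l<n. l \<noteq> j \<longrightarrow> (\<forall>q\<in>W l. dist (fst (z j)) (snd (z j)) \<le> 2 * (sin \<beta> / 4) * dist (fst (z j)) q))"
      by auto
    have ex: "\<exists>c<k. \<forall>x\<in>W j. \<forall>y\<in>W l. t c \<le> dist x y \<and> dist x y \<le> t c + w \<and> K * w < dist x y"
      if "j < n" "l < n" "j \<noteq> l" for j l
      using parts that unfolding homogeneous_parts_def by blast
    have "\<exists>P :: 'a set. finite P \<and> card P = n \<and> flat \<beta> P \<and> nearly_k_distance k \<epsilon> P"
    proof (rule flat_nearly_k_distance_of_twins[OF \<open>0 < \<epsilon>\<close> \<beta>(1,2) w K t])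
      show "K * w < dist ((fst \<circ> z) j) ((snd \<circ> z) j)" if "j < n" for j
        using z[OF that] by simp
      fix j l assume jl: "j < n" "l < n" "j \<noteq> l"
      obtain c where c: "c < k"
        "\<forall>x\<in>W j. \<forall>y\<in>W l. t c \<le> dist x y \<and> dist x y \<le> t c + w \<and> K * w < dist x y"
        using ex[OF jl] by blast
      show "K * w < dist ((fst \<circ> z) j) ((fst \<circ> z) l)"
        using c(2) z[OF jl(1)] z[OF jl(2)] by simp
      show "dist ((fst \<circ> z) j) ((snd \<circ> z) j) \<le> sin \<beta> / 2 * dist ((fst \<circ> z) j) ((fst \<circ> z) l)"
        using z[OF jl(1)] z[OF jl(2)] jl by simp
      show "\<exists>c<k. {dist ((fst \<circ> z) j) ((fst \<circ> z) l), dist ((snd \<circ> z) j) ((fst \<circ> z) l)} \<subseteq> {t c..t c + w}"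
        using c z[OF jl(1)] z[OF jl(2)] by (intro exI[of _ c]) simp
    qed
    moreover have "flat \<beta> P \<Longrightarrow> flat \<alpha> P" for P :: "'a set"
      using \<beta>(3) unfolding flat_def flat_at_def by (meson order_trans)
    ultimately show "\<exists>P :: 'a set. finite P \<and> card P = n \<and> flat \<alpha> P \<and> nearly_k_distance k \<epsilon> P"
      by blast
  qed
qed

subsection \<open>The upper bound\<close>

text \<open>Order of the constants: maximality of \<open>N\<close> gives \<epsilon> and \<alpha>,
  these give \<open>K\<close> and \<open>m\<close>, these with \<gamma> / 4 give \<eta>, and then
  \<theta>, \<open>c\<close> and \<open>n0\<close> are set. None depends on the point set or on
  \<open>t\<close>.\<close>

lemma good_pairs_bound:
  fixes \<gamma> :: real
  assumes "1 \<le> k" "0 < \<gamma>"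
  shows "\<exists>c>0. \<exists>n0::nat. \<forall>n\<ge>n0. \<forall>(S :: 'a::euclidean_space set) t. finite S \<longrightarrow> card S = n \<longrightarrow> separated S \<longrightarrow>
    (\<forall>i. Suc i < k \<longrightarrow> t i \<le> t (Suc i)) \<longrightarrow>
    real (card (good_pairs k (c * real n powr (1 / real DIM('a))) t S))
      \<le> (1 - 1 / real (Nk k TYPE('a)) + \<gamma>) * real n ^ 2 / 2"
proof (cases "Nk k TYPE('a) = 0")
  \<comment> \<open>Here \<open>1 / real 0\<close> is 0, and the bound follows from there being at
    most \<open>n ^ 2\<close> ordered pairs.\<close>
  case True
  have "real (card (good_pairs k (1 * real n powr (1 / real DIM('a))) t S))
      \<le> (1 - 1 / real (Nk k TYPE('a)) + \<gamma>) * real n ^ 2 / 2"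
    if "finite S" "card S = n" for n t and S :: "'a set"
  proof -
    let ?w = "1 * real n powr (1 / real DIM('a))"
    have "2 * card (good_pairs k ?w t S) \<le> card (S \<times> S)"
      using that by (intro order_trans[OF card_good_pairs_le] card_mono) auto
    also have "\<dots> = n ^ 2" using that by (simp add: card_cartesian_product power2_eq_square)
    finally have "2 * real (card (good_pairs k ?w t S)) \<le> real n ^ 2"
      by (metis of_nat_le_iff of_nat_mult of_nat_numeral of_nat_power)
    moreover have "0 \<le> \<gamma> * real n ^ 2" using assms by simp
    ultimately show ?thesis using True by (simp add: algebra_simps)
  qed
  then show ?thesis by (intro exI[of _ 1]) auto
next
  case False
  define N where "N = Nk k TYPE('a)"
  have N: "1 \<le> N" using False by (simp add: N_def)
  obtain \<epsilon> \<alpha> :: real where \<epsilon>\<alpha>: "0 < \<epsilon>" "0 < \<alpha>" and none: "\<not> (\<exists>P :: 'a set.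
     finite P \<and> card P = Suc N \<and> flat \<alpha> P \<and> nearly_k_distance k \<epsilon> P)"
    using ex_no_flat_nearly_k_distance[of k] unfolding N_def by blast
  have "2 \<le> Suc N" using N by simp
  from flat_nearly_k_distance_of_parts[OF \<epsilon>\<alpha> this] obtain K :: real and m :: nat where K: "1 \<le> K"
    and parts: "\<And>k w (t :: nat \<Rightarrow> real) (V :: 'a set) W. \<lbrakk>0 < w; \<forall>i. Suc i < k \<longrightarrow> t i \<le> t (Suc i);
      homogeneous_parts k (\<lambda>c x y. t c \<le> dist x y \<and> dist x y \<le> t c + w \<and> K * w < dist x y)
        (\<lambda>x y. dist x y \<le> K * w) V (Suc N) m W\<rbrakk>
      \<Longrightarrow> \<exists>P :: 'a set. finite P \<and> card P = Suc N \<and> flat \<alpha> P \<and> nearly_k_distance k \<epsilon> P"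
    by blast
  \<comment> \<open>Of the excess density \<gamma>, deleting the close pairs costs \<gamma> / 2 and
    passing to minimum degree costs another \<gamma> / 4.\<close>
  have "0 < \<gamma> / 4" "Suc N \<le> N + 1" using assms by auto
  from homogeneous_multipartite[OF this(1) N \<open>1 \<le> k\<close> this(2), of m, where 'b = 'a]
  obtain \<eta> :: real where \<eta>: "0 < \<eta>" and es: "\<forall>(V :: 'a set) E C. finite V \<longrightarrow> V \<noteq> {} \<longrightarrow>
      (\<forall>c x y. E c x y \<longrightarrow> E c y x) \<longrightarrow> (\<forall>x. C x x) \<longrightarrow> (\<forall>x y. C x y \<longrightarrow> C y x) \<longrightarrow>
      (\<forall>x\<in>V. (1 - 1 / N + \<gamma> / 4) * card V \<le> card {y\<in>V. \<exists>c<k. E c x y}) \<longrightarrow>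
      (\<forall>x\<in>V. card {y\<in>V. C x y} \<le> \<eta> * card V) \<longrightarrow>
      (\<exists>W. homogeneous_parts k E C V (Suc N) m W)"
    by blast
  \<comment> \<open>\<theta> is the proportion of points allowed in a ball of radius
    \<open>K * w\<close>. The first bound controls the deleted pairs; the second gives degree at
    most \<open>\<eta> * card U\<close> in a subset \<open>U\<close> of at least
    \<open>sqrt (\<gamma> / 8) * n\<close> points.\<close>
  define \<theta> where "\<theta> = min (\<gamma> / 2) (\<eta> * sqrt (\<gamma> / 8))"
  have \<theta>: "0 < \<theta>" "\<theta> \<le> \<gamma> / 2" "\<theta> \<le> \<eta> * sqrt (\<gamma> / 8)" using assms \<eta> by (auto simp: \<theta>_def)
  let ?d = "DIM('a)"
  \<comment> \<open>Chosen so that \<open>(3 * (K * w)) ^ ?d = \<theta> * n\<close> for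
    \<open>w = c * real n powr (1 / ?d)\<close>.\<close>
  define c where "c = \<theta> powr (1 / ?d) / (3 * K)"
  have c: "0 < c" using \<theta> K by (simp add: c_def)
  have ck: "(3 * K * c) ^ ?d = \<theta>"
    using K \<theta> by (simp add: c_def powr_realpow[symmetric] powr_powr)
  define a where "a = 1 - 1 / real N"
  have a: "0 \<le> a" "a \<le> 1" using N by (auto simp: a_def)
  \<comment> \<open>The first bound ensures \<open>1 \<le> K * w\<close>, whence
    \<open>2 * (K * w) + 1 \<le> 3 * (K * w)\<close> in the packing bound; the second is the size
    condition for extracting a subset of large minimum degree.\<close>
  define n0 where "n0 = nat \<lceil>max ((1 / (K * c)) ^ ?d) ((1 + \<gamma>) * 8 / \<gamma>)\<rceil> + 1"
  have "real (card (good_pairs k (c * real n powr (1 / ?d)) t S)) \<le> (1 - 1 / real N + \<gamma>) * real n ^ 2 / 2"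
    if n: "n0 \<le> n" and S: "finite S" "card S = n" "separated S" and t: "\<forall>i. Suc i < k \<longrightarrow> t i \<le> t (Suc i)"
    for n t and S :: "'a set"
  proof (rule ccontr)
    define w where "w = c * real n powr (1 / ?d)"
    assume "\<not> ?thesis"
    then have many: "(a + \<gamma>) * real n ^ 2 < 2 * card (good_pairs k w t S)" by (simp add: w_def a_def)
    have n1: "(1 / (K * c)) ^ ?d \<le> real n" "(1 + \<gamma>) * 8 / \<gamma> \<le> real n" "0 < n"
      using n unfolding n0_def by linarith+
    have w: "0 < w" using c n1 by (simp add: w_def)
    have wd: "(3 * (K * w)) ^ ?d = \<theta> * n"
    proof -
      have "(3 * (K * w)) ^ ?d = (3 * K * c) ^ ?d * (real n powr (1 / ?d)) ^ ?d"
        by (simp add: w_def power_mult_distrib)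
      also have "(real n powr (1 / ?d)) ^ ?d = n" using n1(3) by (simp add: powr_realpow[symmetric] powr_powr)
      finally show ?thesis using ck by simp
    qed
    have Kw: "1 \<le> K * w"
    proof -
      have "1 / (K * c) = ((1 / (K * c)) ^ ?d) powr (1 / ?d)"
        using c K by (simp add: powr_realpow[symmetric] powr_powr)
      also have "\<dots> \<le> real n powr (1 / ?d)" using n1(1) c K by (intro powr_mono2) auto
      finally show ?thesis using c K by (simp add: w_def field_simps)
    qed
    define E where "E i x y \<longleftrightarrow> t i \<le> dist x y \<and> dist x y \<le> t i + w \<and> K * w < dist x y" for i and x y :: 'a
    define C where "C x y \<longleftrightarrow> dist x y \<le> K * w" for x y :: 'a
    have Cle: "card {y\<in>S. C x y} \<le> \<theta> * n" for x
    proof -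
      have "real (card {y\<in>S. C x y}) \<le> (2 * (K * w) + 1) ^ ?d"
        using S Kw by (intro card_separated_cball[where x = x]) (auto simp: C_def separated_def)
      also have "\<dots> \<le> (3 * (K * w)) ^ ?d" using Kw by (intro power_mono) auto
      finally show ?thesis using wd by simp
    qed
    let ?O = "{(p, q) \<in> S \<times> S. p \<noteq> q \<and> (\<exists>i<k. t i \<le> dist p q \<and> dist p q \<le> t i + w)}"
    let ?E = "{(x, y) \<in> S \<times> S. \<exists>i<k. E i x y}"
    let ?C = "Sigma S (\<lambda>x. {y\<in>S. C x y})"
    have fin: "finite ?E" by (rule finite_subset[of _ "S \<times> S"]) (use S in auto)
    \<comment> \<open>A good pair that is not an edge of \<open>E\<close> is at distance at most
      \<open>K * w\<close>, hence counted in \<open>?C\<close>.\<close>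
    have "card ?O \<le> card (?E \<union> ?C)"
      using S fin by (intro card_mono) (auto simp: E_def C_def)
    also have "\<dots> \<le> card ?E + card ?C" by (rule card_Un_le)
    finally have "real (card ?O) \<le> card ?E + card ?C" by linarith
    moreover have "real (card ?C) \<le> \<theta> * n * n"
    proof -
      have "real (card ?C) = (\<Sum>x\<in>S. real (card {y\<in>S. C x y}))" using S by (simp add: card_SigmaI)
      also have "\<dots> \<le> (\<Sum>x\<in>S. \<theta> * n)" by (intro sum_mono Cle)
      finally show ?thesis using S by (simp add: mult_ac)
    qed
    moreover have "\<theta> * n * n \<le> \<gamma> / 2 * n ^ 2"
      using mult_right_mono[OF \<theta>(2), of "real n ^ 2"] by (simp add: power2_eq_square)
    moreover have "2 * real (card (good_pairs k w t S)) \<le> card ?O"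
      using card_good_pairs_le[OF S(1), of k w t] by linarith
    ultimately have "(a + \<gamma> / 2) * n ^ 2 \<le> card ?E" using many by (simp add: algebra_simps)
    moreover have "a + \<gamma> / 2 / 2 \<le> \<gamma> / 2 / 4 * n"
      using n1(2) a(2) \<open>0 < \<gamma>\<close> by (simp add: field_simps)
    ultimately obtain U where U: "U \<subseteq> S" "\<gamma> / 2 / 4 * n ^ 2 \<le> real (card U) ^ 2"
        "\<forall>x\<in>U. (a + \<gamma> / 2 / 2) * card U \<le> card {y\<in>U. \<exists>i<k. E i x y}"
      using dense_ex_min_degree_subset[of S "\<lambda>x y. \<exists>i<k. E i x y" a "\<gamma> / 2"] S a \<open>0 < \<gamma>\<close>
      by (auto simp: E_def dist_commute)
    have finU: "finite U" using U(1) S(1) by (rule finite_subset)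
    have cU: "sqrt (\<gamma> / 8) * n \<le> card U"
    proof (rule power2_le_imp_le)
      show "(sqrt (\<gamma> / 8) * n)\<^sup>2 \<le> (real (card U))\<^sup>2" using U(2) \<open>0 < \<gamma>\<close> by (simp add: power_mult_distrib)
    qed simp
    moreover have "0 < sqrt (\<gamma> / 8) * n" using n1 \<open>0 < \<gamma>\<close> by simp
    ultimately have U0: "U \<noteq> {}" by auto
    have CU: "\<forall>x\<in>U. card {y\<in>U. C x y} \<le> \<eta> * card U"
    proof
      fix x
      have "card {y\<in>U. C x y} \<le> card {y\<in>S. C x y}" using U(1) S(1) by (intro card_mono) auto
      then have "real (card {y\<in>U. C x y}) \<le> \<theta> * n" using Cle[of x] by linarith
      also have "\<dots> \<le> \<eta> * sqrt (\<gamma> / 8) * n" using \<theta>(3) by (intro mult_right_mono) auto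
      also have "\<dots> \<le> \<eta> * card U" using cU \<eta> by (simp add: mult.assoc)
      finally show "real (card {y\<in>U. C x y}) \<le> \<eta> * card U" .
    qed
    have degU: "\<forall>x\<in>U. (1 - 1 / N + \<gamma> / 4) * card U \<le> card {y\<in>U. \<exists>i<k. E i x y}"
      using U(3) by (simp add: a_def)
    have Esym: "\<forall>c x y. E c x y \<longrightarrow> E c y x" and Crefl: "\<forall>x. C x x" and Csym: "\<forall>x y. C x y \<longrightarrow> C y x"
      using Kw by (auto simp: E_def C_def dist_commute)
    from es[THEN spec, THEN spec, THEN spec, THEN mp, THEN mp, THEN mp, THEN mp, THEN mp, THEN mp, THEN mp,
        OF finU U0 Esym Crefl Csym degU CU]
    obtain W where "homogeneous_parts k E C U (Suc N) m W" ..
    then have "homogeneous_parts k (\<lambda>c x y. t c \<le> dist x y \<and> dist x y \<le> t c + w \<and> K * w < dist x y)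
        (\<lambda>x y. dist x y \<le> K * w) U (Suc N) m W"
      by (simp add: E_def C_def fun_eq_iff homogeneous_parts_def)
    from parts[OF w t this] none show False by blast
  qed
  then show ?thesis using c unfolding N_def by blast
qed

theorem theorem9:
  assumes "DIM('a::euclidean_space) \<ge> 2" and "k \<ge> 1" and "(\<gamma>::real) > 0"
  shows "(\<exists>n0::nat. \<forall>n\<ge>n0. real (Mw k 1 n TYPE('a))
            \<le> (1 - 1 / real (Nk k TYPE('a)) + \<gamma>) * real n ^ 2 / 2)
       \<and> (\<exists>c>0. \<exists>n0::nat. \<forall>n\<ge>n0. real (Mw k (c * real n powr (1 / real DIM('a))) n TYPE('a))
            \<le> (1 - 1 / real (Nk k TYPE('a)) + \<gamma>) * real n ^ 2 / 2)"
proof -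
  obtain c and n0 :: nat where c: "0 < c" and bound: "\<And>n (S :: 'a set) t. \<lbrakk>n0 \<le> n; finite S; card S = n;
      separated S; \<forall>i. Suc i < k \<longrightarrow> t i \<le> t (Suc i)\<rbrakk> \<Longrightarrow>
      real (card (good_pairs k (c * real n powr (1 / real DIM('a))) t S))
        \<le> (1 - 1 / real (Nk k TYPE('a)) + \<gamma>) * real n ^ 2 / 2"
    using good_pairs_bound[OF assms(2,3), where 'a = 'a] by metis
  \<comment> \<open>From \<open>n1\<close> on, the longer interval length is at least 1, so the
    bound for length 1 follows by monotonicity.\<close>
  define n1 where "n1 = max n0 (nat \<lceil>(1 / c) ^ DIM('a)\<rceil>)"
  have "real (Mw k 1 n TYPE('a)) \<le> (1 - 1 / real (Nk k TYPE('a)) + \<gamma>) * real n ^ 2 / 2" if "n1 \<le> n" for n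
  proof (rule Mw_le)
    fix S :: "'a set" and t :: "nat \<Rightarrow> real"
    assume S: "finite S" "card S = n" "separated S" "\<forall>i. Suc i < k \<longrightarrow> t i \<le> t (Suc i)"
    have "(1 / c) ^ DIM('a) \<le> real n" using that unfolding n1_def by linarith
    then have "((1 / c) ^ DIM('a)) powr (1 / DIM('a)) \<le> real n powr (1 / DIM('a))"
      using c by (intro powr_mono2) auto
    moreover have "((1 / c) ^ DIM('a)) powr (1 / DIM('a)) = 1 / c"
      using c by (simp add: powr_realpow[symmetric] powr_powr)
    ultimately have "1 / c \<le> real n powr (1 / DIM('a))" by linarith
    then have "1 \<le> c * real n powr (1 / DIM('a))" using c by (simp add: divide_le_eq mult.commute)
    then have "card (good_pairs k 1 t S) \<le> card (good_pairs k (c * real n powr (1 / DIM('a))) t S)"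
      using S(1) by (intro card_mono finite_good_pairs good_pairs_mono)
    also have "real \<dots> \<le> (1 - 1 / real (Nk k TYPE('a)) + \<gamma>) * real n ^ 2 / 2"
      using that S by (intro bound) (auto simp: n1_def)
    finally show "real (card (good_pairs k 1 t S)) \<le> (1 - 1 / real (Nk k TYPE('a)) + \<gamma>) * real n ^ 2 / 2"
      by simp
  qed
  moreover have "real (Mw k (c * real n powr (1 / real DIM('a))) n TYPE('a))
      \<le> (1 - 1 / real (Nk k TYPE('a)) + \<gamma>) * real n ^ 2 / 2" if "n0 \<le> n" for n
    using that by (intro Mw_le bound) auto
  ultimately show ?thesis using c by blast
qed

end
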